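(* Let $\omega\in(0,1)$. For all sequences of real numbers $\boldsymbol{a}=\{a_j\}_{j\in\mathbb{N}}$ and $\boldsymbol{b}=\{b_j\}_{j\in\mathbb{N}}$ with $\inf_ja_j>0$ and $\inf_jb_j\ge1$, Monte Carlo integration in the weighted Hermite spaces $\mathcal{H}(K_{s,\omega,\boldsymbol{a},\boldsymbol{b}})$, $s\in\mathbb{N}$, is strongly polynomially MC-tractable, polynomially MC-tractable and weakly MC-tractable.
   Context: Gaussian density: $\varphi_s(\boldsymbol{x})=(2\pi)^{-s/2}\exp(-\boldsymbol{x}\cdot\boldsymbol{x}/2)$ for $\boldsymbol{x}\in\mathbb{R}^s$, where $\cdot$ is the standard inner product. Hermite polynomials: for $k\in\mathbb{N}_0$, $H_k(x)=\frac{(-1)^k}{\sqrt{k!}}\exp(x^2/2)\frac{\mathrm{d}^k}{\mathrm{d}x^k}\exp(-x^2/2)$; for $\boldsymbol{k}=(k_1,\ldots,k_s)\in\mathbb{N}_0^s$, $H_{\boldsymbol{k}}(\boldsymbol{x})=\prod_{j=1}^sH_{k_j}(x_j)$. These form an orthonormal basis of $L^2(\mathbb{R}^s,\varphi_s)$. The $\boldsymbol{k}$th Hermite coefficient of $f$ is $\widehat f(\boldsymbol{k})=\int_{\mathbb{R}^s}f(\boldsymbol{x})H_{\boldsymbol{k}}(\boldsymbol{x})\varphi_s(\boldsymbol{x})\,\mathrm{d}\boldsymbol{x}$. Hermite space: for a summable $r:\mathbb{N}_0^s\to\mathbb{R}^+$, $\mathcal{H}(K_r)$ is the (real) reproducing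 kernel Hilbert space of functions on $\mathbb{R}^s$ with reproducing kernel $K_r(\boldsymbol{x},\boldsymbol{y})=\sum_{\boldsymbol{k}\in\mathbb{N}_0^s}r(\boldsymbol{k})H_{\boldsymbol{k}}(\boldsymbol{x})H_{\boldsymbol{k}}(\boldsymbol{y})$; its inner product is $\langle f,g\rangle_{K_r}=\sum_{\boldsymbol{k}\in\mathbb{N}_0^s}\frac{1}{r(\boldsymbol{k})}\widehat f(\boldsymbol{k})\widehat g(\boldsymbol{k})$ and its norm is $\|f\|_{K_r}=\langle f,f\rangle_{K_r}^{1/2}$. Hermite space of analytic functions: $\mathcal{H}(K_{s,\omega,\boldsymbol{a},\boldsymbol{b}})$ is the Hermite space $\mathcal{H}(K_r)$ for the (summable) function $r=r_{s,\omega,\boldsymbol{a},\boldsymbol{b}}$, $r_{s,\omega,\boldsymbol{a},\boldsymbol{b}}(\boldsymbol{k})=\omega^{\sum_{j=1}^sa_jk_j^{b_j}}$ for $\boldsymbol{k}\in\mathbb{N}_0^s$. Monte Carlo integration: $I_s(f)=\int_{\mathbb{R}^s}f(\boldsymbol{x})\varphi_s(\boldsymbol{x})\,\mathrm{d}\boldsymbol{x}$ and $\mathrm{MC}_{n,s}(\boldsymbol{x}_1,\ldots,\boldsymbol{x}_n;f)=\frac1n\sum_{i=1}^nf(\boldsymbol{x}_i)$, $n\ge1$, where $\boldsymbol{x}_1,\ldots,\boldsymbol{x}_n$ are independent standard normally distributed random variables in $\mathbb{R}^s$. The randomized error in a Hermite space $\mathcal{H}(K_r)$ is $$e^{\mathrm{MC}}(n,s)=\sup_{f\in\mathcal{H}(K_r),\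 \|f\|_{K_r}\le1}\mathbb{E}\left(\left|I_s(f)-\mathrm{MC}_{n,s}(\boldsymbol{x}_1,\ldots,\boldsymbol{x}_n;f)\right|^2\right)^{1/2},$$ and for $\varepsilon\in(0,1)$, $n^{\mathrm{MC}}(\varepsilon,s)=\min\{n\in\mathbb{N},\,n\ge1:\ e^{\mathrm{MC}}(n,s)\le\varepsilon\}$. Tractability notions (for $s\in\mathbb{N}$, $\varepsilon\in(0,1)$): - weak MC-tractability: $\lim_{s+\varepsilon^{-1}\to\infty}\frac{\log(n^{\mathrm{MC}}(\varepsilon,s))}{s+\varepsilon^{-1}}=0$; - polynomial MC-tractability: there exist positive reals $c,p,q$ with $n^{\mathrm{MC}}(\varepsilon,s)\le c\,s^q\varepsilon^{-p}$ for all $s\in\mathbb{N}$, $\varepsilon\in(0,1)$; - strong polynomial MC-tractability: there exist positive reals $c,p$ with $n^{\mathrm{MC}}(\varepsilon,s)\le c\,\varepsilon^{-p}$ for all $s\in\mathbb{N}$, $\varepsilon\in(0,1)$. *)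

theory Defs
  imports "HOL-Probability.Probability" "HOL-Library.Extended_Nat"
begin

section \<open>Euclidean space and Gaussian measure in varying dimension\<close>

text \<open>
  The dimension s is a variable of the problem, so points of \<open>\<real>\<^sup>s\<close> are functions on the index set
  \<open>{1..s}\<close>, extended by \<^const>\<open>undefined\<close>; multi-indices are treated in the same way. The
  space of \<open>leb s\<close> is \<open>Rn s\<close>.
\<close>

definition Rn :: "nat \<Rightarrow> (nat \<Rightarrow> real) set" where
  "Rn s = ({1..s} \<rightarrow>\<^sub>E UNIV)"

definition multi_indices :: "nat \<Rightarrow> (nat \<Rightarrow> nat) set" where
  "multi_indices s = ({1..s} \<rightarrow>\<^sub>E UNIV)"

definition leb :: "nat \<Rightarrow> (nat \<Rightarrow> real) measure" where
  "leb s = PiM {1..s} (\<lambda>_. lborel)"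

definition gauss_density :: "nat \<Rightarrow> (nat \<Rightarrow> real) \<Rightarrow> real" where
  "gauss_density s x = (2 * pi) powr (- real s / 2) * exp (- (\<Sum>j\<in>{1..s}. x j * x j) / 2)"

definition gauss_measure :: "nat \<Rightarrow> (nat \<Rightarrow> real) measure" where
  "gauss_measure s = density (leb s) (\<lambda>x. ennreal (gauss_density s x))"


section \<open>Hermite polynomials and Hermite coefficients\<close>

definition hermite1 :: "nat \<Rightarrow> real \<Rightarrow> real" where
  "hermite1 k x = (-1) ^ k / sqrt (fact k) * exp (x\<^sup>2 / 2) * (deriv ^^ k) (\<lambda>t. exp (- t\<^sup>2 / 2)) x"

definition hermite :: "nat \<Rightarrow> (nat \<Rightarrow> nat) \<Rightarrow> (nat \<Rightarrow> real) \<Rightarrow> real" where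
  "hermite s k x = (\<Prod>j\<in>{1..s}. hermite1 (k j) (x j))"

definition hermite_coeff :: "nat \<Rightarrow> ((nat \<Rightarrow> real) \<Rightarrow> real) \<Rightarrow> (nat \<Rightarrow> nat) \<Rightarrow> real" where
  "hermite_coeff s f k = (\<integral>x. f x * hermite s k x * gauss_density s x \<partial>leb s)"


section \<open>Reproducing kernel Hilbert spaces\<close>

text \<open>
  \<open>is_rkhs X K H ip\<close>: the set H of real functions on X is a Hilbert space under the inner product
  ip, and K is its reproducing kernel. A function on X is represented by its extension by 0, so
  that two functions agreeing on X are equal.
\<close>

definition is_rkhs ::
  "'a set \<Rightarrow> ('a \<Rightarrow> 'a \<Rightarrow> real) \<Rightarrow> ('a \<Rightarrow> real) set \<Rightarrow> (('a \<Rightarrow> real) \<Rightarrow> ('a \<Rightarrow> real) \<Rightarrow> real) \<Rightarrow> bool" where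
  "is_rkhs X K H ip \<longleftrightarrow>
     (\<forall>f\<in>H. \<forall>x. x \<notin> X \<longrightarrow> f x = 0) \<and>
     (\<lambda>x. 0) \<in> H \<and>
     (\<forall>f\<in>H. \<forall>g\<in>H. (\<lambda>x. f x + g x) \<in> H) \<and>
     (\<forall>c. \<forall>f\<in>H. (\<lambda>x. c * f x) \<in> H) \<and>
     (\<forall>f\<in>H. \<forall>g\<in>H. ip f g = ip g f) \<and>
     (\<forall>f\<in>H. \<forall>g\<in>H. \<forall>h\<in>H. ip (\<lambda>x. f x + g x) h = ip f h + ip g h) \<and>
     (\<forall>c. \<forall>f\<in>H. \<forall>g\<in>H. ip (\<lambda>x. c * f x) g = c * ip f g) \<and>
     (\<forall>f\<in>H. 0 \<le> ip f f) \<and>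
     (\<forall>f\<in>H. ip f f = 0 \<longrightarrow> f = (\<lambda>x. 0)) \<and>
     (\<forall>F::nat \<Rightarrow> 'a \<Rightarrow> real. range F \<subseteq> H \<and>
        (\<forall>e>0. \<exists>N. \<forall>m\<ge>N. \<forall>n\<ge>N. sqrt (ip (\<lambda>x. F m x - F n x) (\<lambda>x. F m x - F n x)) < e) \<longrightarrow>
        (\<exists>f\<in>H. (\<lambda>n. sqrt (ip (\<lambda>x. F n x - f x) (\<lambda>x. F n x - f x))) \<longlonglongrightarrow> 0)) \<and>
     (\<forall>y\<in>X. (\<lambda>x. if x \<in> X then K x y else 0) \<in> H \<and>
        (\<forall>f\<in>H. ip f (\<lambda>x. if x \<in> X then K x y else 0) = f y))"


section \<open>Hermite spaces\<close>

definition hermite_kernel ::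
  "nat \<Rightarrow> ((nat \<Rightarrow> nat) \<Rightarrow> real) \<Rightarrow> (nat \<Rightarrow> real) \<Rightarrow> (nat \<Rightarrow> real) \<Rightarrow> real" where
  "hermite_kernel s r x y = (\<Sum>\<^sub>\<infinity>k\<in>multi_indices s. r k * hermite s k x * hermite s k y)"

definition hermite_inner ::
  "nat \<Rightarrow> ((nat \<Rightarrow> nat) \<Rightarrow> real) \<Rightarrow> ((nat \<Rightarrow> real) \<Rightarrow> real) \<Rightarrow> ((nat \<Rightarrow> real) \<Rightarrow> real) \<Rightarrow> real" where
  "hermite_inner s r f g =
     (\<Sum>\<^sub>\<infinity>k\<in>multi_indices s. 1 / r k * hermite_coeff s f k * hermite_coeff s g k)"

definition hermite_norm :: "nat \<Rightarrow> ((nat \<Rightarrow> nat) \<Rightarrow> real) \<Rightarrow> ((nat \<Rightarrow> real) \<Rightarrow> real) \<Rightarrow> real" where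
  "hermite_norm s r f = sqrt (hermite_inner s r f f)"

text \<open>
  The kernel determines the space. For summable positive r the RKHS of \<^const>\<open>hermite_kernel\<close>
  exists and its inner product is \<^const>\<open>hermite_inner\<close>.
\<close>

definition hermite_space :: "nat \<Rightarrow> ((nat \<Rightarrow> nat) \<Rightarrow> real) \<Rightarrow> ((nat \<Rightarrow> real) \<Rightarrow> real) set" where
  "hermite_space s r = (THE H. is_rkhs (Rn s) (hermite_kernel s r) H (hermite_inner s r))"

definition analytic_weight ::
  "real \<Rightarrow> (nat \<Rightarrow> real) \<Rightarrow> (nat \<Rightarrow> real) \<Rightarrow> nat \<Rightarrow> (nat \<Rightarrow> nat) \<Rightarrow> real" where
  "analytic_weight \<omega> a b s k = \<omega> powr (\<Sum>j\<in>{1..s}. a j * real (k j) powr b j)"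


section \<open>Monte Carlo integration\<close>

definition gauss_integral :: "nat \<Rightarrow> ((nat \<Rightarrow> real) \<Rightarrow> real) \<Rightarrow> real" where
  "gauss_integral s f = (\<integral>x. f x * gauss_density s x \<partial>leb s)"

definition MC :: "nat \<Rightarrow> (nat \<Rightarrow> nat \<Rightarrow> real) \<Rightarrow> ((nat \<Rightarrow> real) \<Rightarrow> real) \<Rightarrow> real" where
  "MC n x f = (\<Sum>i\<in>{1..n}. f (x i)) / real n"

definition ennreal_sqrt :: "ennreal \<Rightarrow> ennreal" where
  "ennreal_sqrt t = (if t = \<infinity> then \<infinity> else ennreal (sqrt (enn2real t)))"

text \<open>
  The n independent standard normal sample points are the coordinates of the n-fold product of
  \<^const>\<open>gauss_measure\<close>. Expectation and supremum are taken in \<open>[0,\<infinity>]\<close>, so no integrability or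
  boundedness is built in.
\<close>

definition MC_error :: "nat \<Rightarrow> nat \<Rightarrow> ((nat \<Rightarrow> nat) \<Rightarrow> real) \<Rightarrow> ennreal" where
  "MC_error n s r =
     (SUP f\<in>{f \<in> hermite_space s r. hermite_norm s r f \<le> 1}.
        ennreal_sqrt (\<integral>\<^sup>+x. ennreal (\<bar>gauss_integral s f - MC n x f\<bar>\<^sup>2)
                        \<partial>PiM {1..n} (\<lambda>_. gauss_measure s)))"

text \<open>
  The family r gives the weight function for each dimension. In \<^typ>\<open>enat\<close> the infimum of a nonempty
  set is its minimum, and the value is \<open>\<infinity>\<close> if no n reaches the error \<open>\<epsilon>\<close>.
\<close>

definition MC_complexity :: "(nat \<Rightarrow> (nat \<Rightarrow> nat) \<Rightarrow> real) \<Rightarrow> real \<Rightarrow> nat \<Rightarrow> enat" where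
  "MC_complexity r \<epsilon> s = (INF n\<in>{n. 1 \<le> n \<and> MC_error n s (r s) \<le> ennreal \<epsilon>}. enat n)"


section \<open>Tractability\<close>

definition ln_enat :: "enat \<Rightarrow> ereal" where
  "ln_enat n = (case n of enat m \<Rightarrow> ereal (ln (real m)) | \<infinity> \<Rightarrow> \<infinity>)"

definition weakly_MC_tractable :: "(nat \<Rightarrow> (nat \<Rightarrow> nat) \<Rightarrow> real) \<Rightarrow> bool" where
  "weakly_MC_tractable r \<longleftrightarrow>
     ((\<lambda>(\<epsilon>, s). ln_enat (MC_complexity r \<epsilon> s) / ereal (real s + inverse \<epsilon>)) \<longlongrightarrow> 0)
       (inf (filtercomap (\<lambda>(\<epsilon>, s). real s + inverse \<epsilon>) at_top)
            (principal ({0<..<1} \<times> {1..})))"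

definition polynomially_MC_tractable :: "(nat \<Rightarrow> (nat \<Rightarrow> nat) \<Rightarrow> real) \<Rightarrow> bool" where
  "polynomially_MC_tractable r \<longleftrightarrow>
     (\<exists>c>0. \<exists>p>0. \<exists>q>0. \<forall>s\<ge>1. \<forall>\<epsilon>\<in>{0<..<1}.
        ereal_of_enat (MC_complexity r \<epsilon> s) \<le> ereal (c * real s powr q * \<epsilon> powr (- p)))"

definition strongly_polynomially_MC_tractable :: "(nat \<Rightarrow> (nat \<Rightarrow> nat) \<Rightarrow> real) \<Rightarrow> bool" where
  "strongly_polynomially_MC_tractable r \<longleftrightarrow>
     (\<exists>c>0. \<exists>p>0. \<forall>s\<ge>1. \<forall>\<epsilon>\<in>{0<..<1}.
        ereal_of_enat (MC_complexity r \<epsilon> s) \<le> ereal (c * \<epsilon> powr (- p)))"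

end

theory Submission
  imports Defs
begin

text \<open>
  The mean square error of \<open>n\<close> independent samples is the variance of \<open>f\<close> divided by \<open>n\<close>, and the
  variance is at most \<open>\<Sum>\<^sub>k (coeff f k)\<^sup>2\<close>. All weights are at most 1, so this sum is bounded by the
  squared norm of \<open>f\<close> in the Hermite space. Hence \<open>\<epsilon>\<^sup>-\<^sup>2\<close> samples, rounded up, suffice in every
  dimension.

  The Hermite space is given by a definite description, so its existence and uniqueness have to be
  established. It consists of the functions \<open>\<Sum>\<^sub>k c\<^sub>k H\<^sub>k\<close> with \<open>\<Sum>\<^sub>k c\<^sub>k\<^sup>2 / r\<^sub>k < \<infinity>\<close>. These series converge
  absolutely at every point, because \<open>K(x,x)\<close> is finite there, and \<open>\<integral>K(x,x)\<close> is finite as well, so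
  coefficients and second moments can be computed termwise. Completeness of the Hermite system is not
  needed, since the reproducing property itself expands every element in its coefficients.
\<close>

section \<open>Infinite sums\<close>

text \<open>The difficulty is uniqueness. The formula for the inner product makes sense for every
  function, with default value 0 where an integral or a sum fails to exist, so a competing space
  \<open>H\<close> could contain functions about which only the axioms of \<open>is_rkhs\<close> are
  known. Hence \<open>H\<close> is first embedded into the space of expansions, and only then does a
  projection argument between two nested spaces with the same kernel and inner product give
  equality. The expansions are studied for an abstract orthonormal system on a probability space.
  For the Hermite system the decisive fact is that the kernel diagonal is finite at every point. A
  uniform lower bound \<alpha> of the \<open>a j\<close>, together with \<open>b j\<close> at least
  1, bounds the weight by the product of the (\<omega>^\<alpha>)^(k_j). The multi-index sum then
  factorises, and finiteness reduces to the one-dimensional series of q^k H_k(x)^2 with q =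
  \<omega>^\<alpha> < 1.\<close>

lemma infsum_Cauchy_Schwarz:
  fixes u v :: "'i \<Rightarrow> real"
  assumes u: "(\<lambda>k. (u k)\<^sup>2) summable_on I" and v: "(\<lambda>k. (v k)\<^sup>2) summable_on I"
  shows summable_on_abs_mult: "(\<lambda>k. \<bar>u k * v k\<bar>) summable_on I"
    and infsum_mult_squared_le:
      "(\<Sum>\<^sub>\<infinity>k\<in>I. u k * v k)\<^sup>2 \<le> (\<Sum>\<^sub>\<infinity>k\<in>I. (u k)\<^sup>2) * (\<Sum>\<^sub>\<infinity>k\<in>I. (v k)\<^sup>2)"
proof -
  have "(\<lambda>k. (u k)\<^sup>2 + (v k)\<^sup>2) summable_on I"
    by (intro summable_on_add u v)
  moreover have "\<bar>u k * v k\<bar> \<le> (u k)\<^sup>2 + (v k)\<^sup>2" for k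
    using sum_squares_bound[of "\<bar>u k\<bar>" "\<bar>v k\<bar>"] abs_ge_zero[of "u k * v k"]
    unfolding abs_mult power2_abs by linarith
  ultimately show abs: "(\<lambda>k. \<bar>u k * v k\<bar>) summable_on I"
    by (rule summable_on_comparison_test) auto
  then have "(\<lambda>k. u k * v k) summable_on I"
    by (subst summable_on_iff_abs_summable_on_real) simp
  then have "((\<lambda>F. (\<Sum>k\<in>F. u k * v k)\<^sup>2) \<longlongrightarrow> (\<Sum>\<^sub>\<infinity>k\<in>I. u k * v k)\<^sup>2) (finite_subsets_at_top I)"
    by (intro tendsto_power infsum_tendsto)
  moreover have "(\<Sum>k\<in>F. u k * v k)\<^sup>2 \<le> (\<Sum>\<^sub>\<infinity>k\<in>I. (u k)\<^sup>2) * (\<Sum>\<^sub>\<infinity>k\<in>I. (v k)\<^sup>2)"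
    if "finite F" "F \<subseteq> I" for F
  proof -
    have "(\<Sum>k\<in>F. u k * v k)\<^sup>2 \<le> (\<Sum>k\<in>F. (u k)\<^sup>2) * (\<Sum>k\<in>F. (v k)\<^sup>2)"
      by (rule Cauchy_Schwarz_ineq_sum)
    also have "\<dots> \<le> (\<Sum>\<^sub>\<infinity>k\<in>I. (u k)\<^sup>2) * (\<Sum>\<^sub>\<infinity>k\<in>I. (v k)\<^sup>2)"
      using that u v by (intro mult_mono finite_sum_le_infsum infsum_nonneg sum_nonneg) auto
    finally show ?thesis .
  qed
  then have "eventually (\<lambda>F. (\<Sum>k\<in>F. u k * v k)\<^sup>2
      \<le> (\<Sum>\<^sub>\<infinity>k\<in>I. (u k)\<^sup>2) * (\<Sum>\<^sub>\<infinity>k\<in>I. (v k)\<^sup>2)) (finite_subsets_at_top I)"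
    by (intro eventually_finite_subsets_at_top_weakI) auto
  ultimately show "(\<Sum>\<^sub>\<infinity>k\<in>I. u k * v k)\<^sup>2 \<le> (\<Sum>\<^sub>\<infinity>k\<in>I. (u k)\<^sup>2) * (\<Sum>\<^sub>\<infinity>k\<in>I. (v k)\<^sup>2)"
    by (rule tendsto_upperbound) simp
qed

text \<open>An enumeration turns the unordered sums into series, to which the theorem on termwise
  integration of series applies. Summability is assumed at every point of the space, so that the
  unordered sum and the series agree there.\<close>

lemma
  fixes f :: "'i \<Rightarrow> 'a \<Rightarrow> real"
  assumes I: "countable I"
    and f: "\<And>k. k \<in> I \<Longrightarrow> integrable M (f k)"
    and pt: "\<And>x. x \<in> space M \<Longrightarrow> (\<lambda>k. \<bar>f k x\<bar>) summable_on I"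
    and int: "(\<lambda>k. \<integral>x. \<bar>f k x\<bar> \<partial>M) summable_on I"
  shows integrable_infsum: "integrable M (\<lambda>x. \<Sum>\<^sub>\<infinity>k\<in>I. f k x)"
    and integral_infsum: "(\<integral>x. (\<Sum>\<^sub>\<infinity>k\<in>I. f k x) \<partial>M) = (\<Sum>\<^sub>\<infinity>k\<in>I. \<integral>x. f k x \<partial>M)"
proof -
  have "integrable M (\<lambda>x. \<Sum>\<^sub>\<infinity>k\<in>I. f k x) \<and>
    (\<integral>x. (\<Sum>\<^sub>\<infinity>k\<in>I. f k x) \<partial>M) = (\<Sum>\<^sub>\<infinity>k\<in>I. \<integral>x. f k x \<partial>M)"
  proof (cases "finite I")
    case True
    then show ?thesis using f by (simp add: integral_sum)
  next
    case False
    define e where "e = from_nat_into I"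
    have e: "bij_betw e UNIV I"
      using I False by (simp add: e_def bij_betw_from_nat_into)
    then have eI: "e n \<in> I" for n by (auto simp: bij_betw_def)
    have pt': "(\<lambda>n. \<bar>f (e n) x\<bar>) summable_on UNIV" if "x \<in> space M" for x
      using pt[OF that] summable_on_reindex_bij_betw[OF e, of "\<lambda>k. \<bar>f k x\<bar>"] by simp
    have int': "(\<lambda>n. \<integral>x. \<bar>f (e n) x\<bar> \<partial>M) summable_on UNIV"
      using int summable_on_reindex_bij_betw[OF e, of "\<lambda>k. \<integral>x. \<bar>f k x\<bar> \<partial>M"] by simp
    have eq: "(\<Sum>\<^sub>\<infinity>k\<in>I. f k x) = (\<Sum>n. f (e n) x)" if "x \<in> space M" for x
    proof -
      have "(\<lambda>n. f (e n) x) summable_on UNIV"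
        using pt'[OF that] by (subst summable_on_iff_abs_summable_on_real) simp
      then have "(\<lambda>n. f (e n) x) sums (\<Sum>\<^sub>\<infinity>n. f (e n) x)"
        by (intro has_sum_imp_sums has_sum_infsum)
      then show ?thesis
        using infsum_reindex_bij_betw[OF e, of "\<lambda>k. f k x"] by (simp add: sums_iff)
    qed
    have "(\<lambda>n. \<integral>x. f (e n) x \<partial>M) summable_on UNIV"
      by (subst summable_on_iff_abs_summable_on_real, rule summable_on_comparison_test[OF int'])
        (auto simp: integral_abs_bound)
    then have "(\<lambda>n. \<integral>x. f (e n) x \<partial>M) sums (\<Sum>\<^sub>\<infinity>n. \<integral>x. f (e n) x \<partial>M)"
      by (intro has_sum_imp_sums has_sum_infsum)
    then have eq2: "(\<Sum>\<^sub>\<infinity>k\<in>I. \<integral>x. f k x \<partial>M) = (\<Sum>n. \<integral>x. f (e n) x \<partial>M)"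
      using infsum_reindex_bij_betw[OF e, of "\<lambda>k. \<integral>x. f k x \<partial>M"] by (simp add: sums_iff)
    have s: "AE x in M. summable (\<lambda>n. norm (f (e n) x))"
      using pt' by (intro AE_I2) (simp add: summable_on_imp_summable)
    have i: "summable (\<lambda>n. \<integral>x. norm (f (e n) x) \<partial>M)"
      using int' by (simp add: summable_on_imp_summable)
    show ?thesis
      using integrable_suminf[OF f[OF eI] s i] integral_suminf[OF f[OF eI] s i]
      Bochner_Integration.integrable_cong[of M M, OF refl eq] Bochner_Integration.integral_cong[of M M, OF refl eq] eq2
      by simp
  qed
  then show "integrable M (\<lambda>x. \<Sum>\<^sub>\<infinity>k\<in>I. f k x)"
    and "(\<integral>x. (\<Sum>\<^sub>\<infinity>k\<in>I. f k x) \<partial>M) = (\<Sum>\<^sub>\<infinity>k\<in>I. \<integral>x. f k x \<partial>M)" by auto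
qed

section \<open>Uniqueness of reproducing kernel Hilbert spaces\<close>

context
  fixes X :: "'a set" and K H ip
  assumes H: "is_rkhs X K H ip"
begin

lemma rkhs_add: "f \<in> H \<Longrightarrow> g \<in> H \<Longrightarrow> (\<lambda>x. f x + g x) \<in> H"
  and rkhs_scale: "f \<in> H \<Longrightarrow> (\<lambda>x. c * f x) \<in> H"
  and rkhs_sym: "f \<in> H \<Longrightarrow> g \<in> H \<Longrightarrow> ip f g = ip g f"
  and rkhs_ip_add: "f \<in> H \<Longrightarrow> g \<in> H \<Longrightarrow> k \<in> H \<Longrightarrow> ip (\<lambda>x. f x + g x) k = ip f k + ip g k"
  and rkhs_ip_scale: "f \<in> H \<Longrightarrow> g \<in> H \<Longrightarrow> ip (\<lambda>x. c * f x) g = c * ip f g"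
  and rkhs_nonneg: "f \<in> H \<Longrightarrow> 0 \<le> ip f f"
  and rkhs_definite: "f \<in> H \<Longrightarrow> ip f f = 0 \<Longrightarrow> f = (\<lambda>x. 0)"
  and rkhs_vanish: "f \<in> H \<Longrightarrow> x \<notin> X \<Longrightarrow> f x = 0"
  and rkhs_kernel: "y \<in> X \<Longrightarrow> (\<lambda>x. if x \<in> X then K x y else 0) \<in> H"
  and rkhs_reproducing: "y \<in> X \<Longrightarrow> f \<in> H \<Longrightarrow> ip f (\<lambda>x. if x \<in> X then K x y else 0) = f y"
  using H unfolding is_rkhs_def by blast+

lemma rkhs_complete:
  assumes "\<And>n::nat. F n \<in> H"
    and "\<And>e. e > 0 \<Longrightarrow> \<exists>N. \<forall>m\<ge>N. \<forall>n\<ge>N.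
      sqrt (ip (\<lambda>x. F m x - F n x) (\<lambda>x. F m x - F n x)) < e"
  shows "\<exists>f\<in>H. (\<lambda>n. sqrt (ip (\<lambda>x. F n x - f x) (\<lambda>x. F n x - f x))) \<longlonglongrightarrow> 0"
proof -
  have "\<forall>F::nat \<Rightarrow> 'a \<Rightarrow> real. range F \<subseteq> H \<and>
        (\<forall>e>0. \<exists>N. \<forall>m\<ge>N. \<forall>n\<ge>N. sqrt (ip (\<lambda>x. F m x - F n x) (\<lambda>x. F m x - F n x)) < e) \<longrightarrow>
        (\<exists>f\<in>H. (\<lambda>n. sqrt (ip (\<lambda>x. F n x - f x) (\<lambda>x. F n x - f x))) \<longlonglongrightarrow> 0)"
    using H unfolding is_rkhs_def by (elim conjE) assumption
  then show ?thesis using assms by (simp add: image_subset_iff)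
qed

lemma rkhs_diff: "f \<in> H \<Longrightarrow> g \<in> H \<Longrightarrow> (\<lambda>x. f x - g x) \<in> H"
  using rkhs_add[of f "\<lambda>x. (-1) * g x"] rkhs_scale[of g "-1"] by simp

text \<open>This one expansion serves the whole projection argument: \<open>t\<close> = 1 and
  \<open>t\<close> = -1 combine to the parallelogram law, and general \<open>t\<close> gives the
  first-order condition at a minimum.\<close>

lemma rkhs_quadratic:
  assumes "p \<in> H" "q \<in> H"
  shows "ip (\<lambda>x. p x + t * q x) (\<lambda>x. p x + t * q x) = ip p p + 2 * t * ip p q + t\<^sup>2 * ip q q"
proof -
  define w where "w = (\<lambda>x. p x + t * q x)"
  have w: "w \<in> H" unfolding w_def by (intro rkhs_add rkhs_scale assms)
  have l: "ip w k = ip p k + t * ip q k" if "k \<in> H" for k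
    unfolding w_def using assms that by (simp add: rkhs_ip_add rkhs_ip_scale rkhs_scale)
  have "ip w w = ip p w + t * ip q w" using l[OF w] .
  also have "\<dots> = ip w p + t * ip w q" using rkhs_sym w assms by simp
  also have "\<dots> = ip p p + t * ip q p + t * (ip p q + t * ip q q)" using l assms by simp
  finally show ?thesis using rkhs_sym[OF assms] by (simp add: w_def algebra_simps power2_eq_square)
qed

end

text \<open>
  Minimising the distance from \<open>f \<in> G\<close> to \<open>H\<close> gives \<open>g \<in> H\<close> with \<open>f - g\<close> orthogonal to all kernel
  functions, that is, \<open>f = g\<close>.
\<close>

lemma rkhs_subset_imp_eq:
  assumes H: "is_rkhs X K H ip" and G: "is_rkhs X K G ip" and sub: "H \<subseteq> G"
  shows "H = G"
proof
  show "G \<subseteq> H"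
  proof
    fix f assume f: "f \<in> G"
    define N where "N g = ip g g" for g
    have N0: "0 \<le> N g" if "g \<in> G" for g
      using rkhs_nonneg[OF G that] by (simp add: N_def)
    define S where "S = (\<lambda>v. N (\<lambda>x. f x - v x)) ` H"
    have fdiff: "(\<lambda>x. f x - v x) \<in> G" if "v \<in> H" for v
      using rkhs_diff[OF G f] that sub by auto
    have zero: "(\<lambda>x. 0) \<in> H" using H by (simp add: is_rkhs_def)
    have ne: "S \<noteq> {}" using zero by (auto simp: S_def)
    have bdd: "bdd_below S"
      by (rule bdd_belowI[of _ 0]) (auto simp: S_def intro!: N0 fdiff)
    define d where "d = Inf S"
    have d: "d \<le> N (\<lambda>x. f x - v x)" if "v \<in> H" for v
      unfolding d_def by (rule cInf_lower[OF _ bdd]) (use that in \<open>auto simp: S_def\<close>)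
    have "\<exists>v\<in>H. N (\<lambda>x. f x - v x) < d + 1 / real (Suc n)" for n
    proof -
      have "Inf S < d + 1 / real (Suc n)" by (simp add: d_def)
      from cInf_lessD[OF ne this] show ?thesis by (auto simp: S_def)
    qed
    then obtain v where v: "\<And>n. v n \<in> H"
      and vd: "\<And>n. N (\<lambda>x. f x - v n x) < d + 1 / real (Suc n)" by metis
    \<comment> \<open>Parallelogram law: the midpoint of \<open>v m\<close> and \<open>v n\<close>
      lies in \<open>H\<close>, so its squared distance to \<open>f\<close> is at least
      \<open>d\<close>. This forces the minimising sequence to be Cauchy.\<close>
    have par: "N (\<lambda>x. v m x - v n x) \<le> 2 / real (Suc m) + 2 / real (Suc n)" for m n
    proof -
      let ?p = "\<lambda>x. f x - v m x" and ?q = "\<lambda>x. f x - v n x"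
      note p = fdiff[OF v[of m]] and q = fdiff[OF v[of n]]
      have mid: "(\<lambda>x. 1/2 * (v m x + v n x)) \<in> H"
        by (intro rkhs_scale[OF H] rkhs_add[OF H] v)
      have minus: "N (\<lambda>x. ?q x + (-1) * ?p x) = N ?q + 2 * (-1) * ip ?q ?p + (-1)\<^sup>2 * N ?p"
        unfolding N_def by (rule rkhs_quadratic[OF G q p])
      have plus: "N (\<lambda>x. ?q x + 1 * ?p x) = N ?q + 2 * 1 * ip ?q ?p + 1\<^sup>2 * N ?p"
        unfolding N_def by (rule rkhs_quadratic[OF G q p])
      let ?m = "\<lambda>x. f x - 1/2 * (v m x + v n x)"
      have "N (\<lambda>x. ?m x + 1 * ?m x) = N ?m + 2 * 1 * N ?m + 1\<^sup>2 * N ?m"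
        unfolding N_def by (rule rkhs_quadratic[OF G]) (rule fdiff[OF mid])+
      moreover have "(\<lambda>x. ?m x + 1 * ?m x) = (\<lambda>x. ?q x + 1 * ?p x)"
        by (auto simp: fun_eq_iff field_simps)
      ultimately have four: "N (\<lambda>x. ?q x + 1 * ?p x) \<ge> 4 * d"
        using d[OF mid] by simp
      have "(\<lambda>x. ?q x + (-1) * ?p x) = (\<lambda>x. v m x - v n x)" by auto
      then show ?thesis using minus plus four vd[of m] vd[of n] by simp
    qed
    have "\<exists>g\<in>H. (\<lambda>n. sqrt (ip (\<lambda>x. v n x - g x) (\<lambda>x. v n x - g x))) \<longlonglongrightarrow> 0"
    proof (rule rkhs_complete[OF H v])
      fix e :: real assume e: "e > 0"
      obtain M :: nat where M: "4 / e\<^sup>2 < real M" using reals_Archimedean2 by blast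
      have "sqrt (N (\<lambda>x. v m x - v n x)) < e" if "m \<ge> M" "n \<ge> M" for m n
      proof -
        have "4 / e\<^sup>2 < real (Suc m)" "4 / e\<^sup>2 < real (Suc n)" using that M by auto
        then have "2 / real (Suc m) < e\<^sup>2 / 2" "2 / real (Suc n) < e\<^sup>2 / 2"
          using e by (auto simp: field_simps)
        then have "N (\<lambda>x. v m x - v n x) < e\<^sup>2" using par[of m n] by simp
        then show ?thesis using e real_less_rsqrt real_sqrt_less_iff[of _ "e\<^sup>2"] by simp
      qed
      then show "\<exists>M. \<forall>m\<ge>M. \<forall>n\<ge>M. sqrt (ip (\<lambda>x. v m x - v n x) (\<lambda>x. v m x - v n x)) < e"
        unfolding N_def by blast
    qed
    then obtain g where g: "g \<in> H"
      and lim: "(\<lambda>n. sqrt (N (\<lambda>x. v n x - g x))) \<longlonglongrightarrow> 0" unfolding N_def by blast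
    have lim2: "(\<lambda>n. N (\<lambda>x. v n x - g x)) \<longlonglongrightarrow> 0"
    proof -
      have "(\<lambda>n. (sqrt (N (\<lambda>x. v n x - g x)))\<^sup>2) \<longlonglongrightarrow> 0\<^sup>2" by (intro tendsto_power lim)
      moreover have "N (\<lambda>x. v n x - g x) \<ge> 0" for n
        using rkhs_diff[OF H v g] sub by (intro N0) auto
      ultimately show ?thesis by simp
    qed
    have "f y = g y" for y
    proof (cases "y \<in> X")
      case False
      then show ?thesis using rkhs_vanish[OF G f] rkhs_vanish[OF H g] by simp
    next
      case y: True
      \<comment> \<open>The kernel section at \<open>y\<close> belongs to both spaces: adding
        multiples of it does not leave \<open>H\<close>, and pairing with it evaluates every element
        of \<open>G\<close> at \<open>y\<close>.\<close>
      define w where "w = (\<lambda>x. if x \<in> X then K x y else 0)"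
      have w: "w \<in> H" "w \<in> G" unfolding w_def using rkhs_kernel[OF H y] sub by auto
      have ev: "ip u w = u y" if "u \<in> G" for u
        using rkhs_reproducing[OF G y that] by (simp add: w_def)
      \<comment> \<open>The minimality of \<open>d\<close> is tested at \<open>v n + t w\<close>
        rather than at \<open>g + t w\<close>, so that it never has to be shown that
        \<open>g\<close> attains the minimum. The gap between \<open>v n\<close> and
        \<open>g\<close> is covered by the nonnegativity of \<open>N (v n - g - t w)\<close>, and
        the errors vanish as \<open>n\<close> grows.\<close>
      have key: "t * (f y - g y) \<le> t\<^sup>2 * N w" for t
      proof -
        have "2 * t * (f y - g y) \<le> (1 / real (Suc n) + N (\<lambda>x. v n x - g x)) + 2 * t\<^sup>2 * N w" for n
        proof -
          have p: "(\<lambda>x. f x - v n x) \<in> G" "(\<lambda>x. v n x - g x) \<in> G"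
            using fdiff[OF v] rkhs_diff[OF H v g] sub by auto
          have "d \<le> N (\<lambda>x. f x - (v n x + t * w x))"
            by (intro d rkhs_add[OF H] v rkhs_scale[OF H] w)
          also have "(\<lambda>x. f x - (v n x + t * w x)) = (\<lambda>x. (f x - v n x) + (-t) * w x)" by auto
          also have "N \<dots> = N (\<lambda>x. f x - v n x) + 2 * (-t) * (f y - v n y) + (-t)\<^sup>2 * N w"
            unfolding N_def using rkhs_quadratic[OF G p(1) w(2), of "-t"] ev[OF p(1)] by (simp only:)
          finally have 1: "2 * t * (f y - v n y) \<le> 1 / real (Suc n) + t\<^sup>2 * N w"
            using vd[of n] by simp
          have "0 \<le> N (\<lambda>x. (v n x - g x) + (-t) * w x)"
            by (intro N0 rkhs_add[OF G] p rkhs_scale[OF G] w)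
          also have "\<dots> = N (\<lambda>x. v n x - g x) + 2 * (-t) * (v n y - g y) + (-t)\<^sup>2 * N w"
            unfolding N_def using rkhs_quadratic[OF G p(2) w(2), of "-t"] ev[OF p(2)] by (simp only:)
          finally have 2: "2 * t * (v n y - g y) \<le> N (\<lambda>x. v n x - g x) + t\<^sup>2 * N w" by simp
          show ?thesis using 1 2 by (simp add: algebra_simps)
        qed
        moreover have "(\<lambda>n. (1 / real (Suc n) + N (\<lambda>x. v n x - g x)) + 2 * t\<^sup>2 * N w)
            \<longlonglongrightarrow> (0 + 0) + 2 * t\<^sup>2 * N w"
          by (intro tendsto_add lim2 tendsto_const) (use LIMSEQ_Suc[OF lim_1_over_n] in simp)
        ultimately have "2 * t * (f y - g y) \<le> (0 + 0) + 2 * t\<^sup>2 * N w"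
          by (intro LIMSEQ_le_const) auto
        then show ?thesis by simp
      qed
      have W: "N w \<ge> 0" by (rule N0[OF w(2)])
      \<comment> \<open>A linear term bounded by a quadratic one for all \<open>t\<close> must
        vanish. The summand 1 keeps the denominator positive even if \<open>N w\<close> is
        0.\<close>
      define t where "t = (f y - g y) / (N w + 1)"
      have \<delta>: "f y - g y = t * (N w + 1)" using W by (simp add: t_def)
      have "t * (t * (N w + 1)) \<le> t\<^sup>2 * N w" using key[of t] by (simp only: \<delta>)
      then have "t\<^sup>2 \<le> 0" by (simp add: algebra_simps power2_eq_square)
      then show ?thesis using \<delta> by simp
    qed
    then have "f = g" by auto
    with g show "f \<in> H" by simp
  qed
qed (rule sub)

section \<open>Spaces of orthonormal expansions\<close>

text \<open>\<open>diag_summable\<close> is demanded at every point: summability of \<open>r\<close>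
  alone would give a finite diagonal only almost everywhere, whereas the kernel space consists of
  functions and not of classes.\<close>

locale orthonormal_expansion = prob_space M for M :: "'a measure" +
  fixes I :: "'i set" and h :: "'i \<Rightarrow> 'a \<Rightarrow> real" and r :: "'i \<Rightarrow> real"
  assumes countable_I: "countable I"
    and h_measurable: "k \<in> I \<Longrightarrow> h k \<in> borel_measurable M"
    and h_square_integrable: "k \<in> I \<Longrightarrow> integrable M (\<lambda>x. (h k x)\<^sup>2)"
    and h_orthonormal: "k \<in> I \<Longrightarrow> l \<in> I \<Longrightarrow> (\<integral>x. h k x * h l x \<partial>M) = (if k = l then 1 else 0)"
    and r_pos: "k \<in> I \<Longrightarrow> 0 < r k"
    and r_summable: "r summable_on I"
    and diag_summable: "x \<in> space M \<Longrightarrow> (\<lambda>k. r k * (h k x)\<^sup>2) summable_on I"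
begin

definition coeff :: "('a \<Rightarrow> real) \<Rightarrow> 'i \<Rightarrow> real" where
  "coeff f k = (\<integral>x. f x * h k x \<partial>M)"

definition inner_prod :: "('a \<Rightarrow> real) \<Rightarrow> ('a \<Rightarrow> real) \<Rightarrow> real" where
  "inner_prod f g = (\<Sum>\<^sub>\<infinity>k\<in>I. 1 / r k * coeff f k * coeff g k)"

definition kernel :: "'a \<Rightarrow> 'a \<Rightarrow> real" where
  "kernel x y = (\<Sum>\<^sub>\<infinity>k\<in>I. r k * h k x * h k y)"

definition admissible :: "('i \<Rightarrow> real) \<Rightarrow> bool" where
  "admissible c \<longleftrightarrow> (\<lambda>k. (c k)\<^sup>2 / r k) summable_on I"

text \<open>The extension by 0 follows the convention of \<open>is_rkhs\<close> for functions on a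
  set.\<close>

definition series :: "('i \<Rightarrow> real) \<Rightarrow> 'a \<Rightarrow> real" where
  "series c x = (if x \<in> space M then \<Sum>\<^sub>\<infinity>k\<in>I. c k * h k x else 0)"

definition series_space :: "('a \<Rightarrow> real) set" where
  "series_space = {series c | c. admissible c}"

section \<open>Pointwise convergence and termwise integration of expansions\<close>

lemma r_simps [simp]:
  assumes "k \<in> I"
  shows "0 < r k" "0 \<le> r k" "r k \<noteq> 0"
  using r_pos[OF assms] by auto

lemma h_square_integral: "k \<in> I \<Longrightarrow> (\<integral>x. (h k x)\<^sup>2 \<partial>M) = 1"
  using h_orthonormal[of k k] by (simp add: power2_eq_square)

lemma integrable_square_mult:
  fixes f g :: "'a \<Rightarrow> real"
  assumes [measurable]: "f \<in> borel_measurable M" "g \<in> borel_measurable M"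
    and f: "integrable M (\<lambda>x. (f x)\<^sup>2)" and g: "integrable M (\<lambda>x. (g x)\<^sup>2)"
  shows "integrable M (\<lambda>x. f x * g x)"
    and "(\<integral>x. \<bar>f x * g x\<bar> \<partial>M) \<le> (\<integral>x. (f x)\<^sup>2 \<partial>M) + (\<integral>x. (g x)\<^sup>2 \<partial>M)"
proof -
  have le: "\<bar>f x * g x\<bar> \<le> (f x)\<^sup>2 + (g x)\<^sup>2" for x
    using sum_squares_bound[of "\<bar>f x\<bar>" "\<bar>g x\<bar>"] abs_ge_zero[of "f x * g x"]
    unfolding abs_mult power2_abs by linarith
  have i: "integrable M (\<lambda>x. (f x)\<^sup>2 + (g x)\<^sup>2)" using f g by simp
  show fg: "integrable M (\<lambda>x. f x * g x)"
    by (rule Bochner_Integration.integrable_bound[OF i]) (use le in auto)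
  have "(\<integral>x. \<bar>f x * g x\<bar> \<partial>M) \<le> (\<integral>x. (f x)\<^sup>2 + (g x)\<^sup>2 \<partial>M)"
    using fg i le by (intro integral_mono) auto
  then show "(\<integral>x. \<bar>f x * g x\<bar> \<partial>M) \<le> (\<integral>x. (f x)\<^sup>2 \<partial>M) + (\<integral>x. (g x)\<^sup>2 \<partial>M)"
    using f g by simp
qed

text \<open>Prepares the splitting of \<open>c k * h k x\<close> into
  \<open>c k / sqrt (r k)\<close> and \<open>sqrt (r k) * h k x\<close>, both square summable, to
  which Cauchy-Schwarz applies.\<close>

lemma admissible_iff: "admissible c \<longleftrightarrow> (\<lambda>k. (c k / sqrt (r k))\<^sup>2) summable_on I"
  unfolding admissible_def by (rule summable_on_cong) (simp add: power_divide r_pos less_imp_le)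

lemma r_sqrt: "k \<in> I \<Longrightarrow> c k / sqrt (r k) * (sqrt (r k) * t) = c k * t"
  using r_pos[of k] by simp

lemma diag_sqrt_summable:
  assumes "x \<in> space M"
  shows "(\<lambda>k. (sqrt (r k) * h k x)\<^sup>2) summable_on I"
  using diag_summable[OF assms]
  by (rule summable_on_cong[THEN iffD1, rotated]) (simp add: power_mult_distrib r_pos less_imp_le)

lemma series_abs_summable:
  assumes "admissible c" "x \<in> space M"
  shows "(\<lambda>k. \<bar>c k * h k x\<bar>) summable_on I"
  using summable_on_abs_mult[OF assms(1)[unfolded admissible_iff] diag_sqrt_summable[OF assms(2)]]
  by (rule summable_on_cong[THEN iffD1, rotated]) (simp add: r_sqrt)

lemma series_summable:
  assumes "admissible c" "x \<in> space M"
  shows "(\<lambda>k. c k * h k x) summable_on I"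
  using series_abs_summable[OF assms] by (subst summable_on_iff_abs_summable_on_real) simp

text \<open>The same splitting with \<open>h\<close> replaced by 1, using summability of
  \<open>r\<close>. The resulting l^1 bound provides the dominating series for termwise
  integration.\<close>

lemma admissible_abs_summable:
  assumes "admissible c"
  shows "(\<lambda>k. \<bar>c k\<bar>) summable_on I"
proof -
  have "(\<lambda>k. (sqrt (r k))\<^sup>2) summable_on I"
    using r_summable by (rule summable_on_cong[THEN iffD1, rotated]) (simp add: r_pos less_imp_le)
  from summable_on_abs_mult[OF assms[unfolded admissible_iff] this] show ?thesis
    by (rule summable_on_cong[THEN iffD1, rotated]) (use r_sqrt[where t = 1] in auto)
qed

lemma series_square_le:
  assumes "admissible c" "x \<in> space M"
  shows "(series c x)\<^sup>2 \<le> (\<Sum>\<^sub>\<infinity>k\<in>I. (c k)\<^sup>2 / r k) * (\<Sum>\<^sub>\<infinity>k\<in>I. r k * (h k x)\<^sup>2)"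
proof -
  have "series c x = (\<Sum>\<^sub>\<infinity>k\<in>I. c k / sqrt (r k) * (sqrt (r k) * h k x))"
    using assms(2) unfolding series_def by (auto intro!: infsum_cong simp: r_sqrt)
  moreover have "(\<Sum>\<^sub>\<infinity>k\<in>I. (c k)\<^sup>2 / r k) = (\<Sum>\<^sub>\<infinity>k\<in>I. (c k / sqrt (r k))\<^sup>2)"
    by (rule infsum_cong) (simp add: power_divide r_pos less_imp_le)
  moreover have "(\<Sum>\<^sub>\<infinity>k\<in>I. r k * (h k x)\<^sup>2) = (\<Sum>\<^sub>\<infinity>k\<in>I. (sqrt (r k) * h k x)\<^sup>2)"
    by (rule infsum_cong) (simp add: power_mult_distrib r_pos less_imp_le)
  ultimately show ?thesis
    using infsum_mult_squared_le[OF assms(1)[unfolded admissible_iff] diag_sqrt_summable[OF assms(2)]]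
    by simp
qed

lemma diag_integrable: "integrable M (\<lambda>x. \<Sum>\<^sub>\<infinity>k\<in>I. r k * (h k x)\<^sup>2)"
proof (rule integrable_infsum[OF countable_I])
  show "(\<lambda>k. \<integral>x. \<bar>r k * (h k x)\<^sup>2\<bar> \<partial>M) summable_on I"
    using r_summable
    by (rule summable_on_cong[THEN iffD1, rotated]) (simp add: abs_mult r_pos h_square_integral)
  show "(\<lambda>k. \<bar>r k * (h k x)\<^sup>2\<bar>) summable_on I" if "x \<in> space M" for x
    using diag_summable[OF that]
    by (rule summable_on_cong[THEN iffD1, rotated]) (simp add: abs_mult r_pos)
qed (simp add: h_square_integrable)

text \<open>The integrals of \<bar>f h_k\<bar> are bounded uniformly in \<open>k\<close>, so the
  absolute summability of \<open>c\<close> suffices. The choice \<open>f\<close> = 1 yields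
  measurability, \<open>f = h k\<close> the coefficients, and \<open>f = series c\<close> the
  Parseval identity.\<close>

lemma series_times_integral:
  assumes c: "admissible c" and f: "f \<in> borel_measurable M" "integrable M (\<lambda>x. (f x)\<^sup>2)"
  shows "integrable M (\<lambda>x. series c x * f x)"
    and "(\<integral>x. series c x * f x \<partial>M) = (\<Sum>\<^sub>\<infinity>k\<in>I. c k * coeff f k)"
proof -
  let ?g = "\<lambda>k x. c k * (f x * h k x)"
  have fh: "integrable M (\<lambda>x. f x * h k x)"
    "(\<integral>x. \<bar>f x * h k x\<bar> \<partial>M) \<le> (\<integral>x. (f x)\<^sup>2 \<partial>M) + 1" if "k \<in> I" for k
    using integrable_square_mult[OF f(1) h_measurable[OF that] f(2) h_square_integrable[OF that]]
      h_square_integral[OF that] by auto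
  have s: "series c x * f x = (\<Sum>\<^sub>\<infinity>k\<in>I. ?g k x)" if "x \<in> space M" for x
    using that infsum_cmult_left'[of "\<lambda>k. c k * h k x" "f x" I, symmetric]
    by (simp add: series_def mult_ac)
  have 1: "integrable M (?g k)" if "k \<in> I" for k using fh[OF that] by simp
  have 2: "(\<lambda>k. \<bar>?g k x\<bar>) summable_on I" if "x \<in> space M" for x
    using summable_on_cmult_left[OF series_abs_summable[OF c that], of "\<bar>f x\<bar>"]
    by (simp add: abs_mult mult_ac)
  have 3: "(\<lambda>k. \<integral>x. \<bar>?g k x\<bar> \<partial>M) summable_on I"
  proof (rule summable_on_comparison_test)
    show "(\<lambda>k. \<bar>c k\<bar> * ((\<integral>x. (f x)\<^sup>2 \<partial>M) + 1)) summable_on I"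
      by (intro summable_on_cmult_left admissible_abs_summable c)
    show "(\<integral>x. \<bar>?g k x\<bar> \<partial>M) \<le> \<bar>c k\<bar> * ((\<integral>x. (f x)\<^sup>2 \<partial>M) + 1)" if "k \<in> I" for k
      using fh(2)[OF that] by (simp add: abs_mult[of "c k"] mult_left_mono)
  qed simp
  show "integrable M (\<lambda>x. series c x * f x)"
    using integrable_infsum[OF countable_I 1 2 3] Bochner_Integration.integrable_cong[of M M, OF refl s]
    by simp
  show "(\<integral>x. series c x * f x \<partial>M) = (\<Sum>\<^sub>\<infinity>k\<in>I. c k * coeff f k)"
    using integral_infsum[OF countable_I 1 2 3] Bochner_Integration.integral_cong[of M M, OF refl s]
    by (simp add: coeff_def)
qed

lemma series_measurable: "admissible c \<Longrightarrow> series c \<in> borel_measurable M"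
  using series_times_integral(1)[of c "\<lambda>x. 1"] by simp

lemma series_square_integrable:
  assumes "admissible c"
  shows "integrable M (\<lambda>x. (series c x)\<^sup>2)"
proof (rule Bochner_Integration.integrable_bound)
  show "integrable M (\<lambda>x. (\<Sum>\<^sub>\<infinity>k\<in>I. (c k)\<^sup>2 / r k) * (\<Sum>\<^sub>\<infinity>k\<in>I. r k * (h k x)\<^sup>2))"
    by (simp add: diag_integrable)
  show "(\<lambda>x. (series c x)\<^sup>2) \<in> borel_measurable M"
    using series_measurable[OF assms] by simp
  show "AE x in M. norm ((series c x)\<^sup>2)
      \<le> norm ((\<Sum>\<^sub>\<infinity>k\<in>I. (c k)\<^sup>2 / r k) * (\<Sum>\<^sub>\<infinity>k\<in>I. r k * (h k x)\<^sup>2))"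
    using series_square_le[OF assms] by (intro AE_I2) fastforce
qed

lemma coeff_h:
  assumes "k \<in> I" "l \<in> I"
  shows "coeff (h k) l = (if l = k then 1 else 0)"
  using h_orthonormal[OF assms] by (auto simp: coeff_def)

lemma coeff_series:
  assumes "admissible c" "k \<in> I"
  shows "coeff (series c) k = c k"
proof -
  have "coeff (series c) k = (\<Sum>\<^sub>\<infinity>l\<in>I. c l * coeff (h k) l)"
    unfolding coeff_def[of "series c"]
    by (intro series_times_integral assms h_measurable h_square_integrable)
  also have "\<dots> = (\<Sum>\<^sub>\<infinity>l\<in>{k}. c l)"
    by (rule infsum_cong_neutral) (use assms coeff_h in auto)
  finally show ?thesis by simp
qed

lemma inner_prod_series:
  assumes "admissible c" "admissible d"
  shows "inner_prod (series c) (series d) = (\<Sum>\<^sub>\<infinity>k\<in>I. c k * d k / r k)"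
  unfolding inner_prod_def using assms by (intro infsum_cong) (simp add: coeff_series)

lemma series_second_moment:
  assumes "admissible c"
  shows "(\<integral>x. (series c x)\<^sup>2 \<partial>M) = (\<Sum>\<^sub>\<infinity>k\<in>I. (c k)\<^sup>2)"
  using series_times_integral(2)[OF assms series_measurable[OF assms] series_square_integrable[OF assms]]
  by (simp add: power2_eq_square coeff_series[OF assms] cong: infsum_cong)

lemma second_moment_le_inner_prod:
  assumes f: "f \<in> series_space" and r1: "\<And>k. k \<in> I \<Longrightarrow> r k \<le> 1"
  shows "(\<integral>x. (f x)\<^sup>2 \<partial>M) \<le> inner_prod f f"
proof -
  from f obtain c where c: "admissible c" "f = series c" by (auto simp: series_space_def)
  have le: "(c k)\<^sup>2 \<le> (c k)\<^sup>2 / r k" if "k \<in> I" for k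
    using r1[OF that] r_pos[OF that] mult_left_mono[of "r k" 1 "(c k)\<^sup>2"] by (simp add: field_simps)
  have s: "(\<lambda>k. (c k)\<^sup>2 / r k) summable_on I" using c(1) by (simp add: admissible_def)
  have "(\<Sum>\<^sub>\<infinity>k\<in>I. (c k)\<^sup>2) \<le> (\<Sum>\<^sub>\<infinity>k\<in>I. (c k)\<^sup>2 / r k)"
    by (intro infsum_mono summable_on_comparison_test[OF s] s le) auto
  then show ?thesis
    using c inner_prod_series[OF c(1) c(1)] series_second_moment[OF c(1)]
    by (simp add: power2_eq_square)
qed

section \<open>Linear structure of the space of expansions\<close>

lemma admissible_mult_summable:
  assumes "admissible c" "admissible d"
  shows "(\<lambda>k. c k * d k / r k) summable_on I"
proof -
  have "(\<lambda>k. \<bar>c k / sqrt (r k) * (d k / sqrt (r k))\<bar>) summable_on I"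
    using assms by (intro summable_on_abs_mult) (simp_all add: admissible_iff)
  then have "(\<lambda>k. c k / sqrt (r k) * (d k / sqrt (r k))) summable_on I"
    by (subst summable_on_iff_abs_summable_on_real) simp
  then show ?thesis
    by (rule summable_on_cong[THEN iffD1, rotated]) (simp add: r_pos less_imp_le)
qed

lemma admissible_add:
  assumes "admissible c" "admissible d"
  shows "admissible (\<lambda>k. c k + d k)"
proof -
  have "(\<lambda>k. (c k)\<^sup>2 / r k + 2 * (c k * d k / r k) + (d k)\<^sup>2 / r k) summable_on I"
    using assms by (intro summable_on_add summable_on_cmult_right admissible_mult_summable)
      (simp_all add: admissible_def)
  then show ?thesis
    unfolding admissible_def
    by (rule summable_on_cong[THEN iffD1, rotated])
      (simp add: power2_sum add_divide_distrib)
qed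

lemma admissible_scale:
  assumes "admissible c"
  shows "admissible (\<lambda>k. t * c k)"
  using summable_on_cmult_right[of "\<lambda>k. (c k)\<^sup>2 / r k" I "t\<^sup>2"] assms
  by (simp add: admissible_def power_mult_distrib)

lemma series_add:
  assumes "admissible c" "admissible d"
  shows "series (\<lambda>k. c k + d k) = (\<lambda>x. series c x + series d x)"
  using assms by (auto simp: series_def fun_eq_iff distrib_right series_summable intro!: infsum_add)

lemma series_scale: "series (\<lambda>k. t * c k) = (\<lambda>x. t * series c x)"
  by (auto simp: series_def fun_eq_iff mult.assoc infsum_cmult_right')

lemma admissible_diff:
  assumes "admissible c" "admissible d"
  shows "admissible (\<lambda>k. c k - d k)"
    and "series (\<lambda>k. c k - d k) = (\<lambda>x. series c x - series d x)"
  using admissible_add[OF assms(1) admissible_scale[OF assms(2), of "-1"]]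
    series_add[OF assms(1) admissible_scale[OF assms(2), of "-1"]] series_scale[of "-1" d]
  by simp_all

lemma inner_prod_series_self:
  assumes "admissible c"
  shows "inner_prod (series c) (series c) = (\<Sum>\<^sub>\<infinity>k\<in>I. (c k)\<^sup>2 / r k)"
  using inner_prod_series[OF assms assms] by (simp add: power2_eq_square)

section \<open>Kernel sections and completeness\<close>

lemma admissible_kernel:
  assumes "y \<in> space M"
  shows "admissible (\<lambda>k. r k * h k y)"
  using diag_summable[OF assms] unfolding admissible_def
  by (rule summable_on_cong[THEN iffD1, rotated]) (use r_pos in \<open>force simp: power2_eq_square\<close>)

lemma kernel_eq_series:
  "(\<lambda>x. if x \<in> space M then kernel x y else 0) = series (\<lambda>k. r k * h k y)"
  by (auto simp: series_def kernel_def fun_eq_iff mult_ac)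

lemma coeff_kernel:
  assumes "y \<in> space M" "k \<in> I"
  shows "coeff (\<lambda>x. if x \<in> space M then kernel x y else 0) k = r k * h k y"
  unfolding kernel_eq_series by (intro coeff_series admissible_kernel assms)

text \<open>Here \<open>f\<close> is arbitrary, because \<open>is_rkhs_unique\<close> applies this
  to elements of a space not yet known to consist of expansions.\<close>

lemma inner_prod_kernel:
  assumes "y \<in> space M"
  shows "inner_prod f (\<lambda>x. if x \<in> space M then kernel x y else 0) = (\<Sum>\<^sub>\<infinity>k\<in>I. coeff f k * h k y)"
  unfolding inner_prod_def
proof (rule infsum_cong)
  fix k assume "k \<in> I"
  then show "1 / r k * coeff f k * coeff (\<lambda>x. if x \<in> space M then kernel x y else 0) k
      = coeff f k * h k y"
    using r_pos[of k] by (simp add: coeff_kernel[OF assms])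
qed

text \<open>This is completeness of the l^2 space with weights 1/r: a Cauchy sequence converges
  coordinatewise, and the coordinatewise limit is then shown to be the limit in norm.\<close>

lemma series_complete:
  assumes F: "\<And>n::nat. F n \<in> series_space"
    and Cauchy: "\<And>e. e > 0 \<Longrightarrow> \<exists>N. \<forall>m\<ge>N. \<forall>n\<ge>N.
      sqrt (inner_prod (\<lambda>x. F m x - F n x) (\<lambda>x. F m x - F n x)) < e"
  shows "\<exists>f\<in>series_space. (\<lambda>n. sqrt (inner_prod (\<lambda>x. F n x - f x) (\<lambda>x. F n x - f x))) \<longlonglongrightarrow> 0"
proof -
  from F have "\<forall>n. \<exists>c. admissible c \<and> F n = series c" by (auto simp: series_space_def)
  then obtain c where c: "\<And>n. admissible (c n)" and Fc: "\<And>n. F n = series (c n)" by metis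
  have D: "inner_prod (\<lambda>x. F m x - F n x) (\<lambda>x. F m x - F n x) = (\<Sum>\<^sub>\<infinity>k\<in>I. (c m k - c n k)\<^sup>2 / r k)"
    for m n
    using inner_prod_series_self[OF admissible_diff(1)[OF c c]] admissible_diff(2)[OF c c]
    by (simp add: Fc)
  have part: "(\<Sum>k\<in>J. (c m k - c n k)\<^sup>2 / r k)
      \<le> inner_prod (\<lambda>x. F m x - F n x) (\<lambda>x. F m x - F n x)"
    if "finite J" "J \<subseteq> I" for J m n
    unfolding D by (rule finite_sum_le_infsum)
      (use that admissible_diff(1)[OF c c] r_pos in \<open>auto simp: admissible_def intro!: divide_nonneg_pos\<close>)
  \<comment> \<open>The Cauchy condition is reduced to finite partial sums, uniformly in
    \<open>J\<close>, since coordinatewise limits pass through finite sums.\<close>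
  have ex: "\<exists>N. \<forall>m\<ge>N. \<forall>n\<ge>N. \<forall>J. finite J \<longrightarrow> J \<subseteq> I \<longrightarrow> (\<Sum>k\<in>J. (c m k - c n k)\<^sup>2 / r k) \<le> e\<^sup>2"
    if e: "e > 0" for e
  proof -
    from Cauchy[OF e] obtain N where N: "\<And>m n. m \<ge> N \<Longrightarrow> n \<ge> N \<Longrightarrow>
      sqrt (inner_prod (\<lambda>x. F m x - F n x) (\<lambda>x. F m x - F n x)) < e" by blast
    have "inner_prod (\<lambda>x. F m x - F n x) (\<lambda>x. F m x - F n x) \<le> e\<^sup>2" if "m \<ge> N" "n \<ge> N" for m n
      using N[OF that] by (intro sqrt_le_D) simp
    then have "\<forall>m\<ge>N. \<forall>n\<ge>N. \<forall>J. finite J \<longrightarrow> J \<subseteq> I \<longrightarrow> (\<Sum>k\<in>J. (c m k - c n k)\<^sup>2 / r k) \<le> e\<^sup>2"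
      by (intro allI impI order_trans[OF part])
    then show ?thesis ..
  qed
  have "Cauchy (\<lambda>n. c n k)" if k: "k \<in> I" for k
  proof (rule CauchyI)
    fix e :: real assume e: "e > 0"
    \<comment> \<open>Chosen so that d^2 r_k = (e/2)^2; the halving makes up for the non-strict
      bound in \<open>ex\<close>.\<close>
    define d where "d = e / 2 / sqrt (r k)"
    have d: "d > 0" using e r_pos[OF k] by (simp add: d_def)
    from ex[OF d] obtain N where N: "\<forall>m\<ge>N. \<forall>n\<ge>N. \<forall>J. finite J \<longrightarrow> J \<subseteq> I \<longrightarrow>
      (\<Sum>k\<in>J. (c m k - c n k)\<^sup>2 / r k) \<le> d\<^sup>2" by blast
    have "norm (c m k - c n k) < e" if "m \<ge> N" "n \<ge> N" for m n
    proof -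
      have "(c m k - c n k)\<^sup>2 / r k \<le> d\<^sup>2" using N[rule_format, of m n "{k}"] that k by simp
      then have "(c m k - c n k)\<^sup>2 \<le> (e / 2)\<^sup>2"
        using r_pos[OF k] by (simp add: d_def power_divide field_simps)
      then have "\<bar>c m k - c n k\<bar> \<le> e / 2" using e by (simp add: abs_le_square_iff[symmetric])
      then show ?thesis using e by simp
    qed
    then show "\<exists>N. \<forall>m\<ge>N. \<forall>n\<ge>N. norm (c m k - c n k) < e" by blast
  qed
  then have "\<forall>k\<in>I. \<exists>L. (\<lambda>n. c n k) \<longlonglongrightarrow> L" by (simp add: Cauchy_convergent_iff convergent_def)
  then obtain L where L: "\<And>k. k \<in> I \<Longrightarrow> (\<lambda>n. c n k) \<longlonglongrightarrow> L k" by metis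
  have ex': "\<exists>N. \<forall>n\<ge>N. \<forall>J. finite J \<longrightarrow> J \<subseteq> I \<longrightarrow> (\<Sum>k\<in>J. (c n k - L k)\<^sup>2 / r k) \<le> e\<^sup>2"
    if e: "e > 0" for e
  proof -
    from ex[OF e] obtain N where N: "\<forall>m\<ge>N. \<forall>n\<ge>N. \<forall>J. finite J \<longrightarrow> J \<subseteq> I \<longrightarrow>
      (\<Sum>k\<in>J. (c m k - c n k)\<^sup>2 / r k) \<le> e\<^sup>2" by blast
    have "(\<Sum>k\<in>J. (c n k - L k)\<^sup>2 / r k) \<le> e\<^sup>2" if "n \<ge> N" "finite J" "J \<subseteq> I" for n J
    proof (rule LIMSEQ_le_const2)
      have kI: "\<And>k. k \<in> J \<Longrightarrow> k \<in> I" using that(3) by auto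
      show "(\<lambda>m. \<Sum>k\<in>J. (c n k - c m k)\<^sup>2 / r k) \<longlonglongrightarrow> (\<Sum>k\<in>J. (c n k - L k)\<^sup>2 / r k)"
        using kI by (intro tendsto_sum tendsto_divide tendsto_power tendsto_diff tendsto_const L)
          simp_all
      show "\<exists>M. \<forall>m\<ge>M. (\<Sum>k\<in>J. (c n k - c m k)\<^sup>2 / r k) \<le> e\<^sup>2" using N that by blast
    qed
    then show ?thesis by blast
  qed
  have adm: "admissible (\<lambda>k. c n k - L k) \<and> (\<Sum>\<^sub>\<infinity>k\<in>I. (c n k - L k)\<^sup>2 / r k) \<le> e\<^sup>2"
    if J: "\<forall>J. finite J \<longrightarrow> J \<subseteq> I \<longrightarrow> (\<Sum>k\<in>J. (c n k - L k)\<^sup>2 / r k) \<le> e\<^sup>2" for n e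
  proof -
    have "(\<lambda>k. (c n k - L k)\<^sup>2 / r k) summable_on I"
    proof (rule nonneg_bdd_above_summable_on)
      show "bdd_above (sum (\<lambda>k. (c n k - L k)\<^sup>2 / r k) ` {F. F \<subseteq> I \<and> finite F})"
        by (rule bdd_aboveI[of _ "e\<^sup>2"]) (use J in auto)
    qed (use r_pos in \<open>auto intro!: divide_nonneg_pos\<close>)
    then show ?thesis using J by (auto simp: admissible_def intro!: infsum_le_finite_sums)
  qed
  from ex'[OF zero_less_one] obtain n0 where "\<forall>n\<ge>n0. \<forall>J. finite J \<longrightarrow> J \<subseteq> I \<longrightarrow>
      (\<Sum>k\<in>J. (c n k - L k)\<^sup>2 / r k) \<le> 1\<^sup>2" by blast
  then have "admissible (\<lambda>k. c n0 k - L k)" by (intro adm[THEN conjunct1]) blast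
  \<comment> \<open>\<open>L\<close> is recovered as the difference of \<open>c n0\<close> and
    \<open>c n0 - L\<close>.\<close>
  from admissible_diff(1)[OF c this, of n0] have LA: "admissible L" by simp
  have DL: "inner_prod (\<lambda>x. F n x - series L x) (\<lambda>x. F n x - series L x)
      = (\<Sum>\<^sub>\<infinity>k\<in>I. (c n k - L k)\<^sup>2 / r k)" for n
    using inner_prod_series_self[OF admissible_diff(1)[OF c LA]] admissible_diff(2)[OF c LA]
    by (simp add: Fc)
  have "(\<lambda>n. sqrt (inner_prod (\<lambda>x. F n x - series L x) (\<lambda>x. F n x - series L x))) \<longlonglongrightarrow> 0"
  proof (rule LIMSEQ_I)
    fix e :: real assume e: "e > 0"
    then have "e / 2 > 0" by simp
    from ex'[OF this] obtain N where N': "\<forall>n\<ge>N. \<forall>J. finite J \<longrightarrow> J \<subseteq> I \<longrightarrow>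
      (\<Sum>k\<in>J. (c n k - L k)\<^sup>2 / r k) \<le> (e / 2)\<^sup>2" by blast
    have N: "(\<Sum>\<^sub>\<infinity>k\<in>I. (c n k - L k)\<^sup>2 / r k) \<le> (e / 2)\<^sup>2" if "n \<ge> N" for n
      by (rule adm[THEN conjunct2]) (use N' that in blast)
    have "norm (sqrt (inner_prod (\<lambda>x. F n x - series L x) (\<lambda>x. F n x - series L x)) - 0) < e"
      if "n \<ge> N" for n
    proof -
      have "sqrt (\<Sum>\<^sub>\<infinity>k\<in>I. (c n k - L k)\<^sup>2 / r k) \<le> e / 2"
        using N[OF that] e by (intro real_le_lsqrt) auto
      moreover have "0 \<le> (\<Sum>\<^sub>\<infinity>k\<in>I. (c n k - L k)\<^sup>2 / r k)"
        by (intro infsum_nonneg divide_nonneg_pos r_pos) auto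
      ultimately show ?thesis using e by (simp add: DL)
    qed
    then show "\<exists>N. \<forall>n\<ge>N. norm (sqrt (inner_prod (\<lambda>x. F n x - series L x) (\<lambda>x. F n x - series L x)) - 0) < e"
      by blast
  qed
  moreover have "series L \<in> series_space" using LA by (auto simp: series_space_def)
  ultimately show ?thesis by blast
qed

lemma is_rkhs_series_space: "is_rkhs (space M) kernel series_space inner_prod"
proof -
  have inner_add: "inner_prod (\<lambda>x. f x + g x) k = inner_prod f k + inner_prod g k"
    if fgk: "f \<in> series_space" "g \<in> series_space" "k \<in> series_space" for f g k
  proof -
    obtain u v w where u: "admissible u" "f = series u" and v: "admissible v" "g = series v"
      and w: "admissible w" "k = series w"
      using fgk by (auto simp: series_space_def)
    have "inner_prod (\<lambda>x. f x + g x) k = (\<Sum>\<^sub>\<infinity>k\<in>I. (u k + v k) * w k / r k)"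
      using inner_prod_series[OF admissible_add[OF u(1) v(1)] w(1)] series_add[OF u(1) v(1)] u v w
      by simp
    also have "\<dots> = (\<Sum>\<^sub>\<infinity>k\<in>I. u k * w k / r k) + (\<Sum>\<^sub>\<infinity>k\<in>I. v k * w k / r k)"
      unfolding distrib_right add_divide_distrib
      by (intro infsum_add admissible_mult_summable u v w)
    finally show ?thesis using inner_prod_series u v w by simp
  qed
  have inner_scale: "inner_prod (\<lambda>x. t * f x) g = t * inner_prod f g"
    if fg: "f \<in> series_space" "g \<in> series_space" for t f g
  proof -
    obtain u v where u: "admissible u" "f = series u" and v: "admissible v" "g = series v"
      using fg by (auto simp: series_space_def)
    have "inner_prod (\<lambda>x. t * f x) g = (\<Sum>\<^sub>\<infinity>k\<in>I. (t * u k) * v k / r k)"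
      using inner_prod_series[OF admissible_scale[OF u(1)] v(1), of t] series_scale[of t u] u v
      by simp
    also have "\<dots> = (\<Sum>\<^sub>\<infinity>k\<in>I. t * (u k * v k / r k))" by (simp add: mult.assoc)
    also have "\<dots> = t * (\<Sum>\<^sub>\<infinity>k\<in>I. u k * v k / r k)" by (rule infsum_cmult_right')
    finally show ?thesis using inner_prod_series u v by simp
  qed
  have zero: "(\<lambda>x. 0) \<in> series_space"
    unfolding series_space_def by (auto intro!: exI[of _ "\<lambda>k. 0"] simp: series_def admissible_def)
  have add: "(\<lambda>x. f x + g x) \<in> series_space" if fg: "f \<in> series_space" "g \<in> series_space" for f g
  proof -
    obtain u v where "admissible u" "f = series u" "admissible v" "g = series v"
      using fg by (auto simp: series_space_def)
    then have "admissible (\<lambda>k. u k + v k)" "(\<lambda>x. f x + g x) = series (\<lambda>k. u k + v k)"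
      by (simp_all add: admissible_add series_add)
    then show ?thesis unfolding series_space_def by blast
  qed
  have scale: "(\<lambda>x. t * f x) \<in> series_space" if f: "f \<in> series_space" for t f
  proof -
    obtain u where "admissible u" "f = series u"
      using f by (auto simp: series_space_def)
    then have "admissible (\<lambda>k. t * u k)" "(\<lambda>x. t * f x) = series (\<lambda>k. t * u k)"
      by (simp_all add: admissible_scale series_scale)
    then show ?thesis unfolding series_space_def by blast
  qed
  have sym: "inner_prod f g = inner_prod g f" for f g
    unfolding inner_prod_def by (simp add: mult_ac)
  have nonneg: "0 \<le> inner_prod f f" for f
    unfolding inner_prod_def using r_pos
    by (intro infsum_nonneg) (simp add: mult.assoc less_imp_le)
  have definite: "f = (\<lambda>x. 0)" if f: "f \<in> series_space" "inner_prod f f = 0" for f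
  proof -
    obtain u where u: "admissible u" "f = series u" using f by (auto simp: series_space_def)
    have "(\<Sum>\<^sub>\<infinity>k\<in>I. (u k)\<^sup>2 / r k) \<le> 0" using f u inner_prod_series_self by simp
    from this have "(u k)\<^sup>2 / r k = 0" if "k \<in> I" for k
      by (rule nonneg_infsum_le_0D[where A = I]) (use u(1) that in \<open>auto simp: admissible_def\<close>)
    then have "u k = 0" if "k \<in> I" for k using that r_simps(3)[OF that] by (simp only: divide_eq_0_iff power_eq_0_iff) blast
    then show ?thesis unfolding u(2) series_def by (intro ext) (simp add: infsum_0)
  qed
  have kernel: "(\<lambda>x. if x \<in> space M then kernel x y else 0) \<in> series_space" if "y \<in> space M" for y
    using admissible_kernel[OF that] unfolding kernel_eq_series series_space_def by blast
  have repr: "inner_prod f (\<lambda>x. if x \<in> space M then kernel x y else 0) = f y"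
    if y: "y \<in> space M" and f: "f \<in> series_space" for f y
  proof -
    obtain u where u: "admissible u" "f = series u" using f by (auto simp: series_space_def)
    have "(\<Sum>\<^sub>\<infinity>k\<in>I. coeff f k * h k y) = (\<Sum>\<^sub>\<infinity>k\<in>I. u k * h k y)"
      using coeff_series[OF u(1)] by (intro infsum_cong) (simp add: u)
    then show ?thesis using y by (simp add: inner_prod_kernel u series_def)
  qed
  have vanish: "f x = 0" if "f \<in> series_space" "x \<notin> space M" for f x
    using that by (auto simp: series_space_def series_def)
  show ?thesis
    unfolding is_rkhs_def
    apply (intro conjI ballI allI impI)
    apply (rule vanish, assumption+)
    apply (rule zero)
    apply (rule add, assumption+)
    apply (rule scale, assumption+)
    apply (rule sym)
    apply (rule inner_add, assumption+)
    apply (rule inner_scale, assumption+)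
    apply (rule nonneg)
    apply (rule definite, assumption+)
    subgoal for F by (rule series_complete) auto
    apply (rule kernel, assumption+)
    apply (rule repr, assumption+)
    done
qed

text \<open>
  The reproducing property expands \<open>f \<in> H\<close> in its coefficients. If \<open>\<Sum> (coeff f k)\<^sup>2 / r k\<close> diverges,
  then \<open>inner_prod f f\<close> is the junk value 0, and definiteness forces \<open>f = 0\<close>.
\<close>

lemma is_rkhs_unique:
  assumes H: "is_rkhs (space M) kernel H inner_prod"
  shows "H = series_space"
proof (rule rkhs_subset_imp_eq[OF H is_rkhs_series_space], rule subsetI)
  fix f assume f: "f \<in> H"
  show "f \<in> series_space"
  proof (cases "admissible (coeff f)")
    case True
    have "f = series (coeff f)"
      using rkhs_reproducing[OF H _ f] rkhs_vanish[OF H f]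
      by (auto simp: series_def fun_eq_iff inner_prod_kernel)
    with True show ?thesis by (auto simp: series_space_def)
  next
    case False
    have "inner_prod f f = (\<Sum>\<^sub>\<infinity>k\<in>I. (coeff f k)\<^sup>2 / r k)"
      unfolding inner_prod_def by (simp add: power2_eq_square)
    then have "inner_prod f f = 0"
      using False by (simp add: admissible_def infsum_not_exists)
    then have "f = (\<lambda>x. 0)" by (rule rkhs_definite[OF H f])
    then show ?thesis using is_rkhs_series_space by (simp add: is_rkhs_def)
  qed
qed

lemma the_rkhs: "(THE H. is_rkhs (space M) kernel H inner_prod) = series_space"
  by (rule the_equality) (rule is_rkhs_series_space, rule is_rkhs_unique)

end

section \<open>Hermite polynomials\<close>

text \<open>The unnormalised probabilists' Hermite polynomials. The recursion records, up to sign,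
  what one differentiation does to the polynomial factor in front of exp(-x^2/2).\<close>

primrec Hermite_poly :: "nat \<Rightarrow> real poly" where
  "Hermite_poly 0 = 1"
| "Hermite_poly (Suc n) = [:0, 1:] * Hermite_poly n - pderiv (Hermite_poly n)"

lemma higher_deriv_gauss:
  "(deriv ^^ k) (\<lambda>t::real. exp (- t\<^sup>2 / 2))
    = (\<lambda>x. (-1) ^ k * poly (Hermite_poly k) x * exp (- x\<^sup>2 / 2))"
proof (induction k)
  case (Suc k)
  have "deriv (\<lambda>x. (-1) ^ k * poly (Hermite_poly k) x * exp (- x\<^sup>2 / 2)) x
    = (-1) ^ Suc k * poly (Hermite_poly (Suc k)) x * exp (- x\<^sup>2 / 2)" for x :: real
    by (rule DERIV_imp_deriv)
      (auto intro!: derivative_eq_intros poly_DERIV simp: algebra_simps)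
  then show ?case by (simp only: funpow.simps o_def Suc.IH)
qed simp

lemma hermite1_eq_poly: "hermite1 k x = poly (Hermite_poly k) x / sqrt (fact k)"
proof -
  have "exp (x\<^sup>2 / 2) * exp (- x\<^sup>2 / 2) = 1" by (simp flip: exp_add)
  moreover have "(-1::real) ^ k * (-1) ^ k = 1" by (simp flip: power_mult_distrib)
  moreover have "hermite1 k x = ((-1) ^ k * (-1) ^ k) * (exp (x\<^sup>2 / 2) * exp (- x\<^sup>2 / 2))
      * (poly (Hermite_poly k) x / sqrt (fact k))"
    unfolding hermite1_def higher_deriv_gauss by (simp only: times_divide_eq_left times_divide_eq_right mult_ac)
  ultimately show ?thesis by simp
qed

lemma hermite1_measurable [measurable]: "hermite1 k \<in> borel_measurable borel"
  unfolding hermite1_eq_poly[abs_def]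
  by (intro borel_measurable_continuous_onI continuous_intros) simp

text \<open>The Appell property. It turns the defining recursion into a three-term recurrence and
  drives the induction for orthogonality.\<close>

lemma pderiv_Hermite_poly:
  "pderiv (Hermite_poly (Suc n)) = smult (real (Suc n)) (Hermite_poly n)"
proof (induction n)
  case (Suc n)
  have "pderiv (Hermite_poly (Suc (Suc n)))
      = [:0, 1:] * pderiv (Hermite_poly (Suc n)) + Hermite_poly (Suc n) - pderiv (pderiv (Hermite_poly (Suc n)))"
    by (subst Hermite_poly.simps(2)) (simp add: pderiv_mult pderiv_diff pderiv_pCons)
  also have "\<dots> = smult (real (Suc n)) ([:0, 1:] * Hermite_poly n - pderiv (Hermite_poly n)) + Hermite_poly (Suc n)"
    unfolding Suc.IH pderiv_smult by (simp add: smult_diff_right algebra_simps)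
  also have "\<dots> = smult (real (Suc (Suc n))) (Hermite_poly (Suc n))"
    by (subst Hermite_poly.simps(2)[symmetric]) (metis add.commute of_nat_Suc smult_1_left smult_add_left)
  finally show ?case .
qed (simp add: pderiv_pCons)

text \<open>After division by the leading root the coefficients are x / sqrt(k+2), which tends to 0,
  and sqrt((k+1)/(k+2)), which is at most 1; this is the input for the growth bound in
  \<open>hermite1_square_summable\<close>.\<close>

lemma hermite1_recurrence:
  "sqrt (real (k + 2)) * hermite1 (k + 2) x = x * hermite1 (k + 1) x - sqrt (real (k + 1)) * hermite1 k x"
proof -
  have p: "poly (Hermite_poly (k + 2)) x = x * poly (Hermite_poly (k + 1)) x - real (k + 1) * poly (Hermite_poly k) x"
    using pderiv_Hermite_poly[of k] Hermite_poly.simps(2)[of "Suc k"]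
    by (simp del: Hermite_poly.simps)
  define a where "a = sqrt (fact k :: real)"
  have a: "a > 0" by (simp add: a_def)
  have f1: "sqrt (fact (k + 1)) = sqrt (real (k + 1)) * a"
    by (simp add: a_def real_sqrt_mult)
  have f2: "sqrt (fact (k + 2)) = sqrt (real (k + 2)) * (sqrt (real (k + 1)) * a)"
    by (simp add: a_def real_sqrt_mult)
  have s: "sqrt (real (k + 2)) > 0" "sqrt (real (k + 1)) > 0" by auto
  have "sqrt (real (k + 2)) * hermite1 (k + 2) x
      = (x * poly (Hermite_poly (k + 1)) x - real (k + 1) * poly (Hermite_poly k) x) / (sqrt (real (k + 1)) * a)"
    unfolding hermite1_eq_poly f2 p using s a by (simp del: of_nat_add)
  also have "\<dots> = x * (poly (Hermite_poly (k + 1)) x / (sqrt (real (k + 1)) * a))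
      - real (k + 1) / sqrt (real (k + 1)) * (poly (Hermite_poly k) x / a)"
  proof -
    have "(x * P - c * Q) / (S * a) = x * (P / (S * a)) - c / S * (Q / a)" for P Q c S
      by (simp add: diff_divide_distrib)
    then show ?thesis .
  qed
  also have "real (k + 1) / sqrt (real (k + 1)) = sqrt (real (k + 1))"
    by (rule real_div_sqrt) simp
  finally show ?thesis unfolding hermite1_eq_poly f1 a_def .
qed

section \<open>Orthogonality of Hermite polynomials through Gaussian moments\<close>

definition gauss_moment :: "real poly \<Rightarrow> real" where
  "gauss_moment p = (\<integral>x. std_normal_density x * poly p x \<partial>lborel)"

lemma integrable_gauss_poly: "integrable lborel (\<lambda>x. std_normal_density x * poly p x)"
  unfolding poly_altdef sum_distrib_left
  by (intro Bochner_Integration.integrable_sum)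
    (simp add: mult.left_commute integrable_std_normal_moment)

lemma gauss_moment_add: "gauss_moment (p + q) = gauss_moment p + gauss_moment q"
  unfolding gauss_moment_def by (simp add: distrib_left integrable_gauss_poly)

lemma gauss_moment_smult: "gauss_moment (smult c p) = c * gauss_moment p"
  unfolding gauss_moment_def by (simp add: mult.left_commute)

lemma gauss_moment_diff: "gauss_moment (p - q) = gauss_moment p - gauss_moment q"
  using gauss_moment_add[of "p - q" q] by simp

lemma gauss_moment_0: "gauss_moment 0 = 0"
  by (simp add: gauss_moment_def)

lemma gauss_moment_monom:
  "gauss_moment (monom 1 (2 * k)) = fact (2 * k) / (2 ^ k * fact k)"
  "gauss_moment (monom 1 (2 * k + 1)) = 0"
  unfolding gauss_moment_def poly_monom
  using integral_std_normal_moment_even[of k] integral_std_normal_moment_odd[of k] by simp_all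

lemma gauss_moment_monom_Suc_Suc:
  "gauss_moment (monom 1 (n + 2)) = real (n + 1) * gauss_moment (monom 1 n)"
proof (cases "even n")
  case True
  then obtain k where n: "n = 2 * k" by blast
  have "gauss_moment (monom 1 (n + 2)) = fact (2 * k + 2) / (2 ^ (k + 1) * fact (k + 1))"
    using gauss_moment_monom(1)[of "k + 1"] by (simp add: n)
  also have "fact (2 * k + 2) = (2 * real (k + 1)) * (real (2 * k + 1) * fact (2 * k))"
    by (simp add: algebra_simps)
  also have "2 ^ (k + 1) * fact (k + 1) = (2 * real (k + 1)) * (2 ^ k * fact k)"
    by simp
  also have "(2 * real (k + 1)) * (real (2 * k + 1) * fact (2 * k)) / \<dots>
      = real (2 * k + 1) * (fact (2 * k) / (2 ^ k * fact k))"
    by (simp del: of_nat_add)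
  finally show ?thesis by (simp add: n gauss_moment_monom)
next
  case False
  then obtain k where n: "n = 2 * k + 1" using oddE by blast
  show ?thesis using gauss_moment_monom(2)[of "k + 1"] gauss_moment_monom(2)[of k] by (simp add: n)
qed

text \<open>Gaussian integration by parts (Stein's identity). Both sides are linear in
  \<open>p\<close>, so monomials suffice, and for these it follows from the known moments without
  any boundary terms.\<close>

lemma gauss_moment_mult_X: "gauss_moment ([:0, 1:] * p) = gauss_moment (pderiv p)"
proof -
  have mono: "gauss_moment ([:0, 1:] * monom c i) = gauss_moment (pderiv (monom c i))" for c i
  proof -
    \<comment> \<open>For \<open>i\<close> = 0 the truncated exponent \<open>i - 1\<close> is
      harmless, since the coefficient \<open>real i\<close> vanishes.\<close>
    have "gauss_moment (monom 1 (Suc i)) = gauss_moment (monom (real i) (i - 1))"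
    proof (cases i)
      case 0
      then show ?thesis using gauss_moment_monom(2)[of 0] by (simp add: gauss_moment_0)
    next
      case (Suc j)
      then show ?thesis
        using gauss_moment_monom_Suc_Suc[of j] gauss_moment_smult[of "real (Suc j)" "monom 1 j"]
        by (simp add: smult_monom)
    qed
    then have "gauss_moment (smult c (monom 1 (Suc i))) = gauss_moment (smult c (monom (real i) (i - 1)))"
      by (simp only: gauss_moment_smult)
    then show ?thesis by (simp add: pderiv_monom smult_monom monom_Suc mult.commute)
  qed
  have "gauss_moment ([:0, 1:] * (\<Sum>i\<in>A. monom (coeff p i) i)) = gauss_moment (pderiv (\<Sum>i\<in>A. monom (coeff p i) i))"
    if "finite A" for A
    using that
  proof induction
    case (insert i A)
    then show ?case
      by (simp only: sum.insert[OF insert.hyps] distrib_left gauss_moment_add pderiv_add mono)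
  qed simp
  from this[of "{..degree p}"] show ?thesis by (simp only: poly_as_sum_of_monoms finite_atMost)
qed

text \<open>Under the Gaussian weight the raising operator p -> X p - p' is adjoint to
  differentiation, by Stein's identity and the product rule.\<close>

lemma gauss_moment_Hermite_Suc:
  "gauss_moment (Hermite_poly (Suc m) * q) = gauss_moment (Hermite_poly m * pderiv q)"
proof -
  have "Hermite_poly (Suc m) * q = [:0, 1:] * (Hermite_poly m * q) - q * pderiv (Hermite_poly m)"
    by (simp add: algebra_simps)
  then show ?thesis
    by (simp only: gauss_moment_diff gauss_moment_mult_X pderiv_mult gauss_moment_add)
qed

text \<open>Adjointness and the Appell property lower both indices by one and release a factor
  \<open>n\<close>, so equal indices accumulate the factorial. Unequal indices end with the
  derivative of a constant.\<close>

lemma gauss_moment_Hermite_orthogonal: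
  "gauss_moment (Hermite_poly m * Hermite_poly n) = (if m = n then fact n else 0)"
proof (induction m arbitrary: n)
  case 0
  show ?case
  proof (cases n)
    case 0
    then show ?thesis using gauss_moment_monom(1)[of 0] by simp
  next
    case (Suc l)
    then show ?thesis using gauss_moment_Hermite_Suc[of l 1] by (simp add: gauss_moment_0 del: Hermite_poly.simps(2))
  qed
next
  case (Suc m)
  show ?case
  proof (cases n)
    case 0
    then show ?thesis using gauss_moment_Hermite_Suc[of m 1] by (simp add: gauss_moment_0 del: Hermite_poly.simps(2))
  next
    case (Suc l)
    then show ?thesis
      by (simp add: gauss_moment_Hermite_Suc pderiv_Hermite_poly gauss_moment_smult Suc.IH
          del: Hermite_poly.simps(2))
  qed
qed

lemma hermite1_product_integrable:
  "integrable lborel (\<lambda>x. std_normal_density x * (hermite1 k x * hermite1 l x))"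
  and hermite1_orthonormal:
  "(\<integral>x. std_normal_density x * (hermite1 k x * hermite1 l x) \<partial>lborel) = (if k = l then 1 else 0)"
proof -
  have eq: "std_normal_density x * (hermite1 k x * hermite1 l x)
    = std_normal_density x * poly (Hermite_poly k * Hermite_poly l) x / (sqrt (fact k) * sqrt (fact l))" for x
    by (simp add: hermite1_eq_poly)
  show "integrable lborel (\<lambda>x. std_normal_density x * (hermite1 k x * hermite1 l x))"
    unfolding eq by (intro integrable_divide integrable_gauss_poly)
  show "(\<integral>x. std_normal_density x * (hermite1 k x * hermite1 l x) \<partial>lborel) = (if k = l then 1 else 0)"
    unfolding eq integral_divide_zero gauss_moment_def[symmetric] gauss_moment_Hermite_orthogonal
    by simp
qed

text \<open>
  By the three-term recurrence \<open>\<bar>h\<^sub>k\<bar> + \<bar>h\<^sub>k\<^sub>+\<^sub>1\<bar>\<close> grows in each step by a factor tending to 1, so the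
  ratio test applies.
\<close>

lemma hermite1_square_summable:
  assumes q: "0 < q" "q < 1"
  shows "(\<lambda>k. q ^ k * (hermite1 k x)\<^sup>2) summable_on UNIV"
proof -
  define m where "m k = \<bar>hermite1 k x\<bar> + \<bar>hermite1 (k + 1) x\<bar>" for k
  define t where "t k = \<bar>x\<bar> / sqrt (real (k + 2))" for k :: nat
  have step: "m (Suc k) \<le> (1 + t k) * m k" for k
  proof -
    have s: "sqrt (real (k + 2)) > 0" by simp
    have "sqrt (real (k + 2)) * \<bar>hermite1 (k + 2) x\<bar> = \<bar>x * hermite1 (k + 1) x - sqrt (real (k + 1)) * hermite1 k x\<bar>"
      unfolding hermite1_recurrence[symmetric] by (simp add: abs_mult)
    also have "\<dots> \<le> \<bar>x\<bar> * \<bar>hermite1 (k + 1) x\<bar> + sqrt (real (k + 1)) * \<bar>hermite1 k x\<bar>"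
      using abs_triangle_ineq4[of "x * hermite1 (k + 1) x" "sqrt (real (k + 1)) * hermite1 k x"]
      by (simp add: abs_mult)
    also have "\<dots> \<le> \<bar>x\<bar> * \<bar>hermite1 (k + 1) x\<bar> + sqrt (real (k + 2)) * \<bar>hermite1 k x\<bar>"
      by (intro add_left_mono mult_right_mono) auto
    also have "\<dots> = sqrt (real (k + 2)) * (t k * \<bar>hermite1 (k + 1) x\<bar> + \<bar>hermite1 k x\<bar>)"
      unfolding t_def using s by (simp add: distrib_left)
    finally have "\<bar>hermite1 (k + 2) x\<bar> \<le> t k * \<bar>hermite1 (k + 1) x\<bar> + \<bar>hermite1 k x\<bar>"
      using s mult_le_cancel_left_pos by blast
    \<comment> \<open>Adding this term gives \<bar>H_k\<bar> the same factor \<open>1 + t k\<close>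
      that \<bar>H_(k+1)\<bar> carries.\<close>
    moreover have "0 \<le> t k * \<bar>hermite1 k x\<bar>" by (simp add: t_def)
    ultimately show ?thesis by (simp add: m_def algebra_simps)
  qed
  have "(\<lambda>k. q * (1 + t k)\<^sup>2) \<longlonglongrightarrow> q * (1 + 0)\<^sup>2"
    unfolding t_def by (intro tendsto_intros) real_asymp
  \<comment> \<open>The midpoint of \<open>q\<close> and 1 serves as the ratio, leaving room above
    the limit \<open>q\<close>.\<close>
  then have "eventually (\<lambda>k. q * (1 + t k)\<^sup>2 < (1 + q) / 2) sequentially"
    using q by (intro order_tendstoD) auto
  then obtain N where N: "\<And>k. k \<ge> N \<Longrightarrow> q * (1 + t k)\<^sup>2 < (1 + q) / 2"
    unfolding eventually_sequentially by blast
  have "summable (\<lambda>k. q ^ k * (m k)\<^sup>2)"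
  proof (rule summable_ratio_test)
    show "(1 + q) / 2 < 1" using q by simp
    fix k assume k: "k \<ge> N"
    have "(m (Suc k))\<^sup>2 \<le> ((1 + t k) * m k)\<^sup>2"
      by (rule power_mono[OF step]) (simp add: m_def)
    then have "q ^ Suc k * (m (Suc k))\<^sup>2 \<le> q ^ Suc k * ((1 + t k) * m k)\<^sup>2"
      using q by (intro mult_left_mono) auto
    also have "\<dots> = (q * (1 + t k)\<^sup>2) * (q ^ k * (m k)\<^sup>2)"
      by (simp add: power_mult_distrib)
    also have "\<dots> \<le> (1 + q) / 2 * (q ^ k * (m k)\<^sup>2)"
      using N[OF k] q by (intro mult_right_mono) auto
    finally show "norm (q ^ Suc k * (m (Suc k))\<^sup>2) \<le> (1 + q) / 2 * norm (q ^ k * (m k)\<^sup>2)"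
      using q by simp
  qed
  moreover have "(hermite1 k x)\<^sup>2 \<le> (m k)\<^sup>2" for k
    by (subst abs_le_square_iff[symmetric]) (simp add: m_def)
  then have "norm (q ^ k * (hermite1 k x)\<^sup>2) \<le> q ^ k * (m k)\<^sup>2" for k
    using q by (simp add: mult_left_mono)
  ultimately have "summable (\<lambda>k. q ^ k * (hermite1 k x)\<^sup>2)"
    by (rule summable_comparison_test'[where N = 0])
  then show ?thesis
    using q by (intro summable_nonneg_imp_summable_on) auto
qed

section \<open>Hermite spaces of analytic functions\<close>

lemma space_leb: "space (leb s) = Rn s"
  by (simp add: leb_def Rn_def space_PiM)

lemma gauss_density_eq_prod: "gauss_density s x = (\<Prod>j\<in>{1..s}. std_normal_density (x j))"
proof -
  have "(\<Prod>j\<in>{1..s}. std_normal_density (x j))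
      = (1 / sqrt (2 * pi)) ^ s * exp (- (\<Sum>j\<in>{1..s}. x j * x j) / 2)"
    unfolding std_normal_density_def prod.distrib
    by (simp add: exp_sum[symmetric] sum_negf sum_divide_distrib power2_eq_square)
  also have "(1 / sqrt (2 * pi)) ^ s = (2 * pi) powr (- real s / 2)"
    by (simp add: powr_half_sqrt[symmetric] powr_minus_divide[symmetric] powr_power)
  finally show ?thesis by (simp add: gauss_density_def)
qed

lemma gauss_density_pos: "gauss_density s x > 0"
  unfolding gauss_density_eq_prod by (intro prod_pos) (simp add: normal_density_pos)

lemma gauss_density_measurable [measurable]: "gauss_density s \<in> borel_measurable (leb s)"
  unfolding gauss_density_eq_prod[abs_def] leb_def
  by (intro borel_measurable_prod measurable_compose[OF measurable_component_singleton]) auto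

lemma hermite_measurable [measurable]: "hermite s k \<in> borel_measurable (leb s)"
  unfolding hermite_def[abs_def] leb_def
  by (intro borel_measurable_prod measurable_compose[OF measurable_component_singleton]) auto

lemma space_gauss: "space (gauss_measure s) = Rn s"
  by (simp add: gauss_measure_def space_leb)

lemma sets_gauss [measurable_cong]: "sets (gauss_measure s) = sets (leb s)"
  by (simp add: gauss_measure_def)

lemma prob_space_gauss: "prob_space (gauss_measure s)"
proof
  interpret product_sigma_finite "\<lambda>_::nat. lborel :: real measure" by standard
  have "emeasure (gauss_measure s) (space (gauss_measure s))
      = (\<integral>\<^sup>+x. ennreal (gauss_density s x) * indicator (space (leb s)) x \<partial>leb s)"
    unfolding gauss_measure_def space_density by (rule emeasure_density) auto
  also have "\<dots> = (\<integral>\<^sup>+x. ennreal (gauss_density s x) \<partial>leb s)"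
    by (intro nn_integral_cong) simp
  also have "\<dots> = (\<integral>\<^sup>+x. (\<Prod>j\<in>{1..s}. ennreal (std_normal_density (x j))) \<partial>leb s)"
    by (simp add: gauss_density_eq_prod prod_ennreal)
  also have "\<dots> = (\<Prod>j\<in>{1..s}. \<integral>\<^sup>+x. ennreal (std_normal_density x) \<partial>lborel)"
    unfolding leb_def by (rule product_nn_integral_prod) auto
  also have "\<dots> = 1"
    by (simp add: nn_integral_eq_integral)
  finally show "emeasure (gauss_measure s) (space (gauss_measure s)) = 1" .
qed

text \<open>No measurability of \<open>f\<close> is assumed, because coefficients of arbitrary
  functions have to be identified. As the density is positive, \<open>f\<close> and its product with
  the density are measurable together; otherwise both integrals take the default value 0.\<close>

lemma integral_gauss: "(\<integral>x. f x \<partial>gauss_measure s) = (\<integral>x. f x * gauss_density s x \<partial>leb s)"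
proof (cases "f \<in> borel_measurable (leb s)")
  case True
  then show ?thesis
    unfolding gauss_measure_def
    by (subst integral_real_density) (auto simp: gauss_density_pos less_imp_le mult.commute)
next
  case False
  have "(\<lambda>x. f x * gauss_density s x) \<notin> borel_measurable (leb s)"
  proof
    assume "(\<lambda>x. f x * gauss_density s x) \<in> borel_measurable (leb s)"
    then have "(\<lambda>x. f x * gauss_density s x / gauss_density s x) \<in> borel_measurable (leb s)"
      by measurable
    moreover have "f x * gauss_density s x / gauss_density s x = f x" for x
      using gauss_density_pos[of s x] by simp
    ultimately show False using False by simp
  qed
  moreover have "f \<notin> borel_measurable (gauss_measure s)"
    using False by (simp cong: measurable_cong_sets add: sets_gauss)
  ultimately show ?thesis
    using borel_measurable_integrable not_integrable_integral_eq by metis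
qed

lemma integrable_gauss:
  "f \<in> borel_measurable (leb s) \<Longrightarrow>
    integrable (gauss_measure s) f \<longleftrightarrow> integrable (leb s) (\<lambda>x. gauss_density s x * f x)" for f :: "_ \<Rightarrow> real"
  unfolding gauss_measure_def
  by (subst integrable_real_density) (auto simp: gauss_density_pos less_imp_le)

section \<open>Multivariate Hermite polynomials\<close>

lemma hermite_product_eq:
  "gauss_density s x * (hermite s k x * hermite s l x)
    = (\<Prod>j\<in>{1..s}. std_normal_density (x j) * (hermite1 (k j) (x j) * hermite1 (l j) (x j)))"
  by (simp add: gauss_density_eq_prod hermite_def prod.distrib)

lemma hermite_product_integrable:
  "integrable (gauss_measure s) (\<lambda>x. hermite s k x * hermite s l x)"
proof -
  interpret product_sigma_finite "\<lambda>_::nat. lborel :: real measure" by standard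
  show ?thesis
  proof (subst integrable_gauss)
    show "integrable (leb s) (\<lambda>x. gauss_density s x * (hermite s k x * hermite s l x))"
      unfolding hermite_product_eq leb_def
      by (rule product_integrable_prod) (auto intro: hermite1_product_integrable)
  qed measurable
qed

lemma hermite_orthonormal:
  assumes "k \<in> multi_indices s" "l \<in> multi_indices s"
  shows "(\<integral>x. hermite s k x * hermite s l x \<partial>gauss_measure s) = (if k = l then 1 else 0)"
proof -
  interpret product_sigma_finite "\<lambda>_::nat. lborel :: real measure" by standard
  have "(\<integral>x. hermite s k x * hermite s l x \<partial>gauss_measure s)
      = (\<integral>x. (\<Prod>j\<in>{1..s}. std_normal_density (x j) * (hermite1 (k j) (x j) * hermite1 (l j) (x j))) \<partial>leb s)"
    unfolding integral_gauss hermite_product_eq[symmetric] by (simp add: mult.commute)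
  also have "\<dots> = (\<Prod>j\<in>{1..s}. \<integral>x. std_normal_density x * (hermite1 (k j) x * hermite1 (l j) x) \<partial>lborel)"
    unfolding leb_def
    by (rule product_integral_prod) (auto intro: hermite1_product_integrable)
  also have "\<dots> = (\<Prod>j\<in>{1..s}. if k j = l j then 1 else 0)"
    by (simp only: hermite1_orthonormal)
  also have "\<dots> = (if k = l then 1 else 0)"
  proof (cases "k = l")
    case False
    \<comment> \<open>Multi-indices are extensional, so distinct ones differ inside
      \<open>{1..s}\<close>, and that coordinate contributes a factor 0.\<close>
    then obtain j where "j \<in> {1..s}" "k j \<noteq> l j"
      using PiE_ext[of k "{1..s}" "\<lambda>_. UNIV" l] assms by (auto simp: multi_indices_def)
    then show ?thesis using False by (auto intro!: bexI[of _ j])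
  qed simp
  finally show ?thesis .
qed

lemma countable_multi_indices: "countable (multi_indices s)"
  unfolding multi_indices_def by (intro countable_PiE) auto

text \<open>A finite product of absolutely convergent series may be multiplied out; the product rule
  is that of \<open>Infinite_Set_Sum\<close>, whose notion of absolute summability is
  equivalent.\<close>

lemma summable_on_multi_indices_prod:
  fixes g :: "nat \<Rightarrow> nat \<Rightarrow> real"
  assumes "\<And>j. j \<in> {1..s} \<Longrightarrow> (\<lambda>n. \<bar>g j n\<bar>) summable_on UNIV"
  shows "(\<lambda>k. \<Prod>j\<in>{1..s}. g j (k j)) summable_on multi_indices s"
proof -
  have "Infinite_Set_Sum.abs_summable_on (g j) UNIV" if "j \<in> {1..s}" for j
    using assms[OF that] unfolding abs_summable_equivalent[symmetric] by simp
  then have "Infinite_Set_Sum.abs_summable_on (\<lambda>k. \<Prod>j\<in>{1..s}. g j (k j)) (multi_indices s)"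
    unfolding multi_indices_def by (intro abs_summable_on_prod_PiE) auto
  then show ?thesis
    unfolding abs_summable_equivalent[symmetric] by (rule abs_summable_summable)
qed

context
  fixes \<omega> \<alpha> :: real and a b :: "nat \<Rightarrow> real"
  assumes \<omega>: "0 < \<omega>" "\<omega> < 1" and \<alpha>: "0 < \<alpha>"
    and a: "\<And>j. j \<ge> 1 \<Longrightarrow> \<alpha> \<le> a j" and b: "\<And>j. j \<ge> 1 \<Longrightarrow> 1 \<le> b j"
begin

text \<open>For natural \<open>n\<close> and exponent at least 1 a power does not fall below
  \<open>n\<close>, and a base \<omega> < 1 reverses the order. The geometric bound is the same for
  all coordinates \<open>j\<close>.\<close>

lemma weight_factor_le:
  assumes "j \<ge> 1"
  shows "\<omega> powr (a j * real n powr b j) \<le> (\<omega> powr \<alpha>) ^ n"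
proof -
  \<comment> \<open>At \<open>n\<close> = 0 both sides are 0, as \<open>powr\<close> with base 0
    gives 0.\<close>
  have "real n \<le> real n powr b j"
  proof (cases "n = 0")
    case False
    then have "real n powr 1 \<le> real n powr b j" using b[OF assms] by (intro powr_mono) auto
    then show ?thesis by simp
  qed simp
  then have "\<alpha> * real n \<le> a j * real n powr b j"
    using a[OF assms] \<alpha> by (intro mult_mono) auto
  then have "\<omega> powr (a j * real n powr b j) \<le> \<omega> powr (\<alpha> * real n)"
    using \<omega> by (intro powr_mono') auto
  then show ?thesis using \<omega> by (simp add: powr_powr[symmetric] powr_realpow)
qed

lemma analytic_weight_eq_prod:
  "analytic_weight \<omega> a b s k = (\<Prod>j\<in>{1..s}. \<omega> powr (a j * real (k j) powr b j))"
  unfolding analytic_weight_def using \<omega> by (intro powr_sum) auto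

lemma analytic_weight_le_1: "analytic_weight \<omega> a b s k \<le> 1"
proof -
  have "0 \<le> (\<Sum>j\<in>{1..s}. a j * real (k j) powr b j)"
    using a \<alpha> by (intro sum_nonneg mult_nonneg_nonneg) (force intro: order_trans)+
  then show ?thesis
    using \<omega> unfolding analytic_weight_def by (intro powr_le1) auto
qed

lemma weight_base_bounds: "0 < \<omega> powr \<alpha>" "\<omega> powr \<alpha> < 1"
  using \<omega> \<alpha> by (simp_all add: powr01_less_one)

text \<open>Used twice: \<open>g\<close> = 1 gives summability of the weights, and \<open>g\<close>
  = squared Hermite values gives the kernel diagonal.\<close>

lemma weight_factor_summable:
  assumes "j \<ge> 1" and g: "\<And>n. 0 \<le> g n" "(\<lambda>n. (\<omega> powr \<alpha>) ^ n * g n) summable_on UNIV"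
  shows "(\<lambda>n. \<bar>\<omega> powr (a j * real n powr b j) * g n\<bar>) summable_on UNIV"
  by (rule summable_on_comparison_test[OF g(2)])
    (simp_all add: abs_mult g(1) mult_right_mono weight_factor_le[OF assms(1)])

lemma analytic_weight_summable: "analytic_weight \<omega> a b s summable_on multi_indices s"
  unfolding analytic_weight_eq_prod[abs_def]
proof (rule summable_on_multi_indices_prod)
  fix j assume "j \<in> {1..s}"
  moreover have "(\<lambda>n. (\<omega> powr \<alpha>) ^ n * 1) summable_on UNIV"
    using weight_base_bounds by (intro summable_nonneg_imp_summable_on) (auto intro: summable_geometric)
  ultimately show "(\<lambda>n. \<bar>\<omega> powr (a j * real n powr b j)\<bar>) summable_on UNIV"
    using weight_factor_summable[of j "\<lambda>_. 1"] by simp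
qed

lemma analytic_weight_diag_summable:
  "(\<lambda>k. analytic_weight \<omega> a b s k * (hermite s k x)\<^sup>2) summable_on multi_indices s"
proof -
  have "(\<lambda>k. \<Prod>j\<in>{1..s}. \<omega> powr (a j * real (k j) powr b j) * (hermite1 (k j) (x j))\<^sup>2)
    summable_on multi_indices s"
    by (intro summable_on_multi_indices_prod weight_factor_summable hermite1_square_summable weight_base_bounds) auto
  then show ?thesis
    by (simp add: analytic_weight_eq_prod hermite_def prod.distrib prod_power_distrib)
qed

lemma orthonormal_expansion_hermite:
  "orthonormal_expansion (gauss_measure s) (multi_indices s) (hermite s) (analytic_weight \<omega> a b s)"
proof (rule orthonormal_expansion.intro[OF prob_space_gauss], unfold_locales)
  show "hermite s k \<in> borel_measurable (gauss_measure s)" for k by measurable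
  show "integrable (gauss_measure s) (\<lambda>x. (hermite s k x)\<^sup>2)" for k
    using hermite_product_integrable[of s k k] by (simp add: power2_eq_square)
  show "0 < analytic_weight \<omega> a b s k" for k using \<omega> by (simp add: analytic_weight_def)
  show "(\<lambda>k. analytic_weight \<omega> a b s k * (hermite s k x)\<^sup>2) summable_on multi_indices s" for x
    by (rule analytic_weight_diag_summable)
qed (use countable_multi_indices hermite_orthonormal analytic_weight_summable in auto)

end

section \<open>Monte Carlo error and tractability\<close>

text \<open>After centring, the squared error is a double sum over pairs of samples. Independence
  removes the off-diagonal pairs, each diagonal pair contributes the variance, and the variance is
  at most the second moment.\<close>

lemma (in prob_space) nn_integral_sample_mean_error:
  fixes f :: "'a \<Rightarrow> real"
  assumes f: "f \<in> borel_measurable M" and f2: "integrable M (\<lambda>x. (f x)\<^sup>2)"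
    and J: "finite J" "J \<noteq> {}"
  shows "(\<integral>\<^sup>+x. ennreal (\<bar>expectation f - (\<Sum>i\<in>J. f (x i)) / card J\<bar>\<^sup>2) \<partial>PiM J (\<lambda>_. M))
    \<le> ennreal (expectation (\<lambda>x. (f x)\<^sup>2) / card J)"
proof -
  interpret P: product_prob_space "\<lambda>_. M" J by standard
  interpret PS: prob_space "PiM J (\<lambda>_. M)" by (rule prob_space_PiM) (rule prob_space_axioms)
  have intf: "integrable M f"
    using square_integrable_imp_integrable[OF f f2] .
  define g where "g x = f x - expectation f" for x
  have g2: "integrable M (\<lambda>x. (g x)\<^sup>2)"
    unfolding g_def power2_diff using f2 intf by simp
  have g1: "integrable M g" and g0: "expectation g = 0"
    unfolding g_def using intf by (auto simp: prob_space)
  have V: "expectation (\<lambda>x. (g x)\<^sup>2) \<le> expectation (\<lambda>x. (f x)\<^sup>2)"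
    using variance_eq[OF intf f2] by (simp add: g_def)
  \<comment> \<open>One factor per coordinate, with product \<open>g (x i) * g (x j)\<close> over
    \<open>J\<close>. This form, which includes \<open>i = j\<close>, allows the Fubini rules for
    products of one-variable functions to be applied.\<close>
  define u where "u i j l = (if i = j then (if l = i then (\<lambda>x. (g x)\<^sup>2) else (\<lambda>x. 1))
      else (if l = i \<or> l = j then g else (\<lambda>x. 1)))" for i j l :: 'b
  have u: "(\<Prod>l\<in>J. u i j l (x l)) = g (x i) * g (x j)" if "i \<in> J" "j \<in> J" for i j x
  proof (cases "i = j")
    case True
    have "(\<Prod>l\<in>J. u i j l (x l)) = (\<Prod>l\<in>J. if l = i then (g (x i))\<^sup>2 else 1)"
      using True by (intro prod.cong) (auto simp: u_def)
    then show ?thesis using True J that by (simp add: power2_eq_square)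
  next
    case False
    have "(\<Prod>l\<in>J. u i j l (x l)) = (\<Prod>l\<in>J. (if l = i then g (x i) else 1) * (if l = j then g (x j) else 1))"
      using False by (intro prod.cong) (auto simp: u_def)
    then show ?thesis using J that by (simp add: prod.distrib)
  qed
  have iu: "integrable M (u i j l)" for i j l using g1 g2 by (simp add: u_def)
  have int: "integrable (PiM J (\<lambda>_. M)) (\<lambda>x. g (x i) * g (x j))" if "i \<in> J" "j \<in> J" for i j
    using P.product_integrable_prod[OF J(1), of "u i j"] iu u[OF that] by simp
  have val: "(\<integral>x. g (x i) * g (x j) \<partial>PiM J (\<lambda>_. M)) = (if i = j then expectation (\<lambda>x. (g x)\<^sup>2) else 0)"
    if "i \<in> J" "j \<in> J" for i j
  proof -
    have "(\<integral>x. g (x i) * g (x j) \<partial>PiM J (\<lambda>_. M)) = (\<Prod>l\<in>J. expectation (u i j l))"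
      using P.product_integral_prod[OF J(1), of "u i j"] iu u[OF that] by simp
    also have "\<dots> = (if i = j then expectation (\<lambda>x. (g x)\<^sup>2) else 0)"
    proof (cases "i = j")
      case True
      have "(\<Prod>l\<in>J. expectation (u i j l)) = (\<Prod>l\<in>J. if l = i then expectation (\<lambda>x. (g x)\<^sup>2) else 1)"
        using True by (intro prod.cong) (auto simp: u_def prob_space)
      then show ?thesis using True J that by simp
    next
      case False
      have "expectation (u i j i) = 0" using False g0 by (simp add: u_def)
      then show ?thesis using False J that by (simp, intro bexI[of _ i])
    qed
    finally show ?thesis .
  qed
  have n: "real (card J) > 0" using J by (simp add: card_gt_0_iff)
  have sq: "\<bar>expectation f - (\<Sum>i\<in>J. f (x i)) / card J\<bar>\<^sup>2
      = (\<Sum>i\<in>J. \<Sum>j\<in>J. g (x i) * g (x j)) / (card J)\<^sup>2" for x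
  proof -
    have "(\<Sum>i\<in>J. f (x i)) = (\<Sum>i\<in>J. g (x i)) + card J * expectation f"
      by (simp add: g_def sum_subtractf)
    then have "(expectation f - (\<Sum>i\<in>J. f (x i)) / card J) = - (\<Sum>i\<in>J. g (x i)) / card J"
      using n by (simp add: add_divide_distrib)
    then show ?thesis
      by (simp add: power_divide power2_eq_square sum_product)
  qed
  have "(\<integral>\<^sup>+x. ennreal (\<bar>expectation f - (\<Sum>i\<in>J. f (x i)) / card J\<bar>\<^sup>2) \<partial>PiM J (\<lambda>_. M))
      = ennreal (\<integral>x. \<bar>expectation f - (\<Sum>i\<in>J. f (x i)) / card J\<bar>\<^sup>2 \<partial>PiM J (\<lambda>_. M))"
  proof (rule nn_integral_eq_integral)
    show "integrable (PiM J (\<lambda>_. M)) (\<lambda>x. \<bar>expectation f - (\<Sum>i\<in>J. f (x i)) / card J\<bar>\<^sup>2)"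
      unfolding sq by (intro integrable_divide Bochner_Integration.integrable_sum int)
  qed simp
  also have "(\<integral>x. \<bar>expectation f - (\<Sum>i\<in>J. f (x i)) / card J\<bar>\<^sup>2 \<partial>PiM J (\<lambda>_. M))
      = (\<Sum>i\<in>J. \<Sum>j\<in>J. if i = j then expectation (\<lambda>x. (g x)\<^sup>2) else 0) / (card J)\<^sup>2"
    unfolding sq by (simp add: Bochner_Integration.integral_sum int val)
  also have "\<dots> = expectation (\<lambda>x. (g x)\<^sup>2) / card J"
    using J n by (simp add: power2_eq_square)
  also have "\<dots> \<le> expectation (\<lambda>x. (f x)\<^sup>2) / card J"
    using V n by (simp add: divide_right_mono)
  finally show ?thesis by (simp add: ennreal_leI)
qed

lemma ennreal_sqrt_le:
  assumes "t \<le> ennreal c" "0 \<le> c"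
  shows "ennreal_sqrt t \<le> ennreal (sqrt c)"
proof -
  have "t \<noteq> \<infinity>" using assms(1) by (auto simp: top_unique)
  moreover have "enn2real t \<le> c" using assms enn2real_leI by blast
  ultimately show ?thesis by (simp add: ennreal_sqrt_def ennreal_leI)
qed

text \<open>Here the definite description is resolved: kernel and inner product agree with the
  abstract ones as functions on all arguments, so \<open>the_rkhs\<close> identifies the Hermite
  space.\<close>

lemma MC_error_le:
  assumes h: "orthonormal_expansion (gauss_measure s) (multi_indices s) (hermite s) r"
    and r1: "\<And>k. k \<in> multi_indices s \<Longrightarrow> r k \<le> 1"
    and n: "n \<ge> 1"
  shows "MC_error n s r \<le> ennreal (sqrt (1 / real n))"
proof -
  interpret H: orthonormal_expansion "gauss_measure s" "multi_indices s" "hermite s" r by (fact h)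
  have coeff: "H.coeff f k = hermite_coeff s f k" for f k
    unfolding H.coeff_def hermite_coeff_def integral_gauss ..
  have inner: "hermite_inner s r = H.inner_prod"
    by (simp add: fun_eq_iff hermite_inner_def H.inner_prod_def coeff)
  have kernel: "hermite_kernel s r = H.kernel"
    by (simp add: fun_eq_iff hermite_kernel_def H.kernel_def)
  have space: "hermite_space s r = H.series_space"
    unfolding hermite_space_def inner kernel using H.the_rkhs by (simp add: space_gauss)
  show ?thesis
    unfolding MC_error_def
  proof (rule SUP_least)
    fix f assume "f \<in> {f \<in> hermite_space s r. hermite_norm s r f \<le> 1}"
    then have f: "f \<in> H.series_space" and norm: "H.inner_prod f f \<le> 1"
      by (auto simp: space hermite_norm_def inner)
    from f obtain c where "H.admissible c" "f = H.series c" by (auto simp: H.series_space_def)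
    then have meas: "f \<in> borel_measurable (gauss_measure s)"
      and int: "integrable (gauss_measure s) (\<lambda>x. (f x)\<^sup>2)"
      by (simp_all add: H.series_measurable H.series_square_integrable)
    have "H.expectation (\<lambda>x. (f x)\<^sup>2) \<le> 1"
      using H.second_moment_le_inner_prod[OF f r1] norm by simp
    then have "H.expectation (\<lambda>x. (f x)\<^sup>2) / real (card {1..n}) \<le> 1 / real n"
      by (simp add: divide_right_mono)
    have "(\<integral>\<^sup>+x. ennreal (\<bar>gauss_integral s f - MC n x f\<bar>\<^sup>2) \<partial>PiM {1..n} (\<lambda>_. gauss_measure s))
        = (\<integral>\<^sup>+x. ennreal (\<bar>H.expectation f - (\<Sum>i\<in>{1..n}. f (x i)) / card {1..n}\<bar>\<^sup>2)
            \<partial>PiM {1..n} (\<lambda>_. gauss_measure s))"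
      by (simp add: gauss_integral_def integral_gauss MC_def)
    also have "\<dots> \<le> ennreal (H.expectation (\<lambda>x. (f x)\<^sup>2) / card {1..n})"
      using n by (intro H.nn_integral_sample_mean_error meas int) auto
    also have "\<dots> \<le> ennreal (1 / real n)"
      by (rule ennreal_leI) fact
    finally show "ennreal_sqrt (\<integral>\<^sup>+x. ennreal (\<bar>gauss_integral s f - MC n x f\<bar>\<^sup>2)
        \<partial>PiM {1..n} (\<lambda>_. gauss_measure s)) \<le> ennreal (sqrt (1 / real n))"
      by (intro ennreal_sqrt_le) auto
  qed
qed

lemma MC_complexity_bounds:
  assumes err: "\<And>n. n \<ge> 1 \<Longrightarrow> MC_error n s (r s) \<le> ennreal (sqrt (1 / real n))"
    and \<epsilon>: "0 < \<epsilon>" "\<epsilon> < 1"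
  obtains n where "MC_complexity r \<epsilon> s = enat n" "1 \<le> n" "real n \<le> 2 / \<epsilon>\<^sup>2"
proof -
  define m where "m = nat \<lceil>1 / \<epsilon>\<^sup>2\<rceil>"
  \<comment> \<open>Rounding up adds at most 1, which is below 1/\<epsilon>^2; this is the origin of
    the constant 2.\<close>
  have e1: "1 / \<epsilon>\<^sup>2 > 1" using \<epsilon> by (simp add: power_less_one_iff)
  then have m: "1 / \<epsilon>\<^sup>2 \<le> real m" "real m \<le> 1 / \<epsilon>\<^sup>2 + 1"
    unfolding m_def by linarith+
  have m1: "m \<ge> 1" using m e1 by linarith
  have "1 / real m \<le> \<epsilon>\<^sup>2" using m m1 \<epsilon> by (simp add: field_simps)
  then have "sqrt (1 / real m) \<le> \<epsilon>" using \<epsilon> by (intro real_le_lsqrt) auto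
  then have "MC_error m s (r s) \<le> ennreal \<epsilon>"
    using err[OF m1] by (meson ennreal_leI order_trans)
  with m1 have upper: "MC_complexity r \<epsilon> s \<le> enat m"
    unfolding MC_complexity_def by (intro INF_lower) auto
  then obtain n where n: "MC_complexity r \<epsilon> s = enat n" "n \<le> m"
    by (cases "MC_complexity r \<epsilon> s") auto
  \<comment> \<open>The lower bound makes the logarithm nonnegative in the proof of weak
    tractability.\<close>
  have "enat 1 \<le> MC_complexity r \<epsilon> s"
    unfolding MC_complexity_def by (intro INF_greatest) auto
  moreover have "real n \<le> 2 / \<epsilon>\<^sup>2"
    using n(2) m e1 by simp
  ultimately show thesis using n(1) that by simp
qed

text \<open>With t = s + 1/\<epsilon> the bound on \<open>n\<close> is at most 2 t^2, so the
  quotient is squeezed between 0 and (ln 2 + 2 ln t) / t.\<close>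

lemma weakly_MC_tractable_if:
  assumes bd: "\<And>s \<epsilon>. s \<ge> 1 \<Longrightarrow> 0 < \<epsilon> \<Longrightarrow> \<epsilon> < 1 \<Longrightarrow>
    \<exists>n. MC_complexity r \<epsilon> s = enat n \<and> 1 \<le> n \<and> real n \<le> 2 / \<epsilon>\<^sup>2"
  shows "weakly_MC_tractable r"
proof -
  define t :: "real \<times> nat \<Rightarrow> real" where "t = (\<lambda>(\<epsilon>, s). real s + inverse \<epsilon>)"
  define F where "F = inf (filtercomap t at_top) (principal ({0<..<1} \<times> {1..}))"
  define v where "v = (\<lambda>(\<epsilon>, s). ln_enat (MC_complexity r \<epsilon> s) / ereal (real s + inverse \<epsilon>))"
  define g where "g x = (ln 2 + 2 * ln x) / x" for x :: real
  have bounds: "0 \<le> v p \<and> v p \<le> ereal (g (t p))" if P: "p \<in> {0<..<1} \<times> {1..}" for p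
  proof -
    obtain \<epsilon> s where p: "p = (\<epsilon>, s)" "0 < \<epsilon>" "\<epsilon> < 1" "s \<ge> 1" using P by (cases p) auto
    obtain n where n: "MC_complexity r \<epsilon> s = enat n" "1 \<le> n" "real n \<le> 2 / \<epsilon>\<^sup>2"
      using bd[OF p(4,2,3)] by blast
    have tp: "t p = real s + inverse \<epsilon>" by (simp add: t_def p)
    have pos: "inverse \<epsilon> > 0" using p by simp
    then have sum_pos: "real s + inverse \<epsilon> > 0" by (intro add_nonneg_pos) auto
    have "real n \<le> 2 * (inverse \<epsilon>)\<^sup>2" using n(3) by (simp add: field_simps)
    also have "\<dots> \<le> 2 * (t p)\<^sup>2" unfolding tp using pos by (intro mult_left_mono power_mono) auto
    finally have "ln (real n) \<le> ln (2 * (t p)\<^sup>2)"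
      using n(2) by (intro ln_mono) auto
    also have "\<dots> = ln 2 + 2 * ln (t p)"
      using sum_pos tp by (simp add: ln_mult ln_realpow)
    finally have "ln (real n) / t p \<le> g (t p)"
      unfolding g_def using sum_pos tp by (intro divide_right_mono) auto
    moreover have "0 \<le> ln (real n) / t p" using n(2) sum_pos tp by simp
    moreover have "v p = ereal (ln (real n) / t p)"
      using sum_pos tp by (simp add: v_def p n ln_enat_def)
    ultimately show ?thesis by simp
  qed
  have ev: "eventually (\<lambda>p. p \<in> {0<..<1} \<times> {1..}) F"
    unfolding F_def by (rule filter_leD[OF inf_le2]) (simp add: eventually_principal)
  have "filterlim t at_top F"
    unfolding F_def by (rule filterlim_mono[OF filterlim_filtercomap order_refl inf_le1])
  moreover have "(g \<longlongrightarrow> 0) at_top" unfolding g_def by real_asymp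
  ultimately have "((\<lambda>p. g (t p)) \<longlongrightarrow> 0) F" by (rule filterlim_compose[rotated])
  then have lim: "((\<lambda>p. ereal (g (t p))) \<longlongrightarrow> 0) F" by (simp add: zero_ereal_def)
  have "(v \<longlongrightarrow> 0) F"
    by (rule tendsto_sandwich[OF _ _ tendsto_const lim])
      (use ev bounds in \<open>auto elim: eventually_mono\<close>)
  then show ?thesis
    unfolding weakly_MC_tractable_def F_def t_def v_def .
qed

lemma strongly_polynomially_MC_tractable_if:
  assumes bd: "\<And>s \<epsilon>. s \<ge> 1 \<Longrightarrow> 0 < \<epsilon> \<Longrightarrow> \<epsilon> < 1 \<Longrightarrow>
    \<exists>n. MC_complexity r \<epsilon> s = enat n \<and> 1 \<le> n \<and> real n \<le> 2 / \<epsilon>\<^sup>2"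
  shows "strongly_polynomially_MC_tractable r"
proof -
  have "ereal_of_enat (MC_complexity r \<epsilon> s) \<le> ereal (2 * \<epsilon> powr (- 2))"
    if "s \<ge> 1" "\<epsilon> \<in> {0<..<1}" for s \<epsilon>
    using bd[of s \<epsilon>] that by (auto simp: powr_minus powr_numeral divide_inverse)
  then show ?thesis
    unfolding strongly_polynomially_MC_tractable_def
    by (intro exI[of _ 2] conjI allI impI ballI) auto
qed

text \<open>The definition asks for a positive exponent of \<open>s\<close>; exponent 1 will do,
  since the extra factor is at least 1.\<close>

lemma strongly_polynomially_imp_polynomially_MC_tractable:
  assumes "strongly_polynomially_MC_tractable r"
  shows "polynomially_MC_tractable r"
proof -
  from assms obtain c p where cp: "c > 0" "p > 0"
    and bd: "\<And>s \<epsilon>. s \<ge> 1 \<Longrightarrow> \<epsilon> \<in> {0<..<1} \<Longrightarrow>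
      ereal_of_enat (MC_complexity r \<epsilon> s) \<le> ereal (c * \<epsilon> powr (- p))"
    unfolding strongly_polynomially_MC_tractable_def by blast
  have "ereal_of_enat (MC_complexity r \<epsilon> s) \<le> ereal (c * real s powr 1 * \<epsilon> powr (- p))"
    if s: "s \<ge> 1" "\<epsilon> \<in> {0<..<1}" for s \<epsilon>
  proof (rule order_trans[OF bd[OF s]])
    have "c * 1 \<le> c * real s powr 1" using s cp by (intro mult_left_mono) auto
    then show "ereal (c * \<epsilon> powr (- p)) \<le> ereal (c * real s powr 1 * \<epsilon> powr (- p))"
      by (simp add: mult_right_mono)
  qed
  then show ?thesis
    unfolding polynomially_MC_tractable_def using cp zero_less_one by blast
qed

theorem theorem3:
  fixes \<omega> :: real and a b :: "nat \<Rightarrow> real"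
  assumes "0 < \<omega>" and "\<omega> < 1"
    and "(INF j\<in>{1..}. ereal (a j)) > 0"
    and "(INF j\<in>{1..}. ereal (b j)) \<ge> 1"
  shows "strongly_polynomially_MC_tractable (analytic_weight \<omega> a b)
       \<and> polynomially_MC_tractable (analytic_weight \<omega> a b)
       \<and> weakly_MC_tractable (analytic_weight \<omega> a b)"
proof -
  \<comment> \<open>The infimum lives in \<open>ereal\<close>; a real number strictly between 0 and
    it serves as the uniform lower bound.\<close>
  from ereal_dense2[OF assms(3)] obtain \<alpha> where \<alpha>: "0 < ereal \<alpha>" "ereal \<alpha> < (INF j\<in>{1..}. ereal (a j))"
    by blast
  have a: "\<alpha> \<le> a j" if "j \<ge> 1" for j
  proof -
    have "(INF j\<in>{1..}. ereal (a j)) \<le> ereal (a j)" using that by (intro INF_lower) auto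
    with \<alpha>(2) have "ereal \<alpha> < ereal (a j)" by (rule less_le_trans)
    then show ?thesis by simp
  qed
  have b: "1 \<le> b j" if "j \<ge> 1" for j
  proof -
    have "(INF j\<in>{1..}. ereal (b j)) \<le> ereal (b j)" using that by (intro INF_lower) auto
    with assms(4) have "1 \<le> ereal (b j)" by (rule order_trans)
    then show ?thesis by simp
  qed
  have \<alpha>0: "0 < \<alpha>" using \<alpha>(1) by simp
  have "\<exists>n. MC_complexity (analytic_weight \<omega> a b) \<epsilon> s = enat n \<and> 1 \<le> n \<and> real n \<le> 2 / \<epsilon>\<^sup>2"
    if "0 < \<epsilon>" "\<epsilon> < 1" for s \<epsilon>
  proof -
    have "MC_error n s (analytic_weight \<omega> a b s) \<le> ennreal (sqrt (1 / real n))" if "n \<ge> 1" for n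
      using orthonormal_expansion_hermite[OF assms(1,2) \<alpha>0 a b]
        analytic_weight_le_1[OF assms(1,2) \<alpha>0 a b] that
      by (intro MC_error_le) auto
    from MC_complexity_bounds[where r = "analytic_weight \<omega> a b", OF this that] show ?thesis by metis
  qed
  then have bd: "\<And>s \<epsilon>. s \<ge> 1 \<Longrightarrow> 0 < \<epsilon> \<Longrightarrow> \<epsilon> < 1 \<Longrightarrow>
    \<exists>n. MC_complexity (analytic_weight \<omega> a b) \<epsilon> s = enat n \<and> 1 \<le> n \<and> real n \<le> 2 / \<epsilon>\<^sup>2"
    by blast
  show ?thesis
    using strongly_polynomially_MC_tractable_if[OF bd] weakly_MC_tractable_if[OF bd]
      strongly_polynomially_imp_polynomially_MC_tractable by blast
qed

end
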